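(* Let $n\ge1$. The chain order $\le_C$ and the induced Duflo order $\le_D$ coincide on the set $\mathbf{T}_n^2$ (which indexes the orbital varieties of nilpotent order 2 in $\mathfrak{sl}_n$): for all $T,S\in\mathbf{T}_n^2$, $T\le_C S$ if and only if $T\le_D S$.
   Context: A (Young) tableau with entry set $E=\{m_1<\dots<m_n\}\subset\mathbb{Z}_{>0}$ is a filling of a Young diagram with $n$ boxes by the elements of $E$, each used once, increasing along rows and down columns. It is standard if $E=\{1,\dots,n\}$. $\mathbf{T}_n$ is the set of standard tableaux with $n$ boxes and $\mathbf{T}_n^2\subset\mathbf{T}_n$ the subset of those with at most two columns. Shapes: $\mathrm{sh}(T)=(\lambda_1\ge\lambda_2\ge\dots)$ is the list of column lengths. Dominance order: $\lambda\ge\mu$ iff $\sum_{m\le i}\lambda_m\ge\sum_{m\le i}\mu_m$ for all $i$ not exceeding the number of parts of either. Projections: for $1\le i<j\le n$, $\pi_{i,j}(T)$ is obtained from $T$ by removing the entries $m_1,\dots,m_{i-1},m_{j+1},\dots,m_n$ by jeu de taquin (to remove an entry, delete it, repeatedly slide into the hole the smaller of the entries immediately to its right and immediately below it, until the hole is at an outer corner, then discard the hole; the final result does not depend on the order of removals). Chain order: $T\le_C S$ iff $\mathrm{sh}(\pi_{i,j}(T))\le\mathrm{sh}(\pi_{i,j}(S))$ for all $1\le i<j\le n$. Right weak order: for words $w=[a_1,\dots,a_n]$ and $y$ which are arrangements of $\{1,\dots,n\}$, let $p_w(i)$ be the position of $i$ in $w$. Put $w\le_D y$ iff for all $i<j$,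 $p_w(j)<p_w(i)$ implies $p_y(j)<p_y(i)$. Insertion: for a column $C$ and $j\notin C$, if some entry of $C$ is greater than $j$, then $j$ replaces the smallest such entry, which is bumped and inserted in the same way in the next column; otherwise $j$ is placed at the bottom of $C$ (an empty column receives $j$). $j\Rightarrow T$ is the tableau obtained by inserting $j$ into $T$ starting with the first column. For $w=[a_1,\dots,a_n]$, $T(w):=a_1\Rightarrow(a_2\Rightarrow(\cdots\Rightarrow(a_n)))$, and $\mathcal{C}_T:=\{w: T(w)=T\}$. Induced Duflo order on $\mathbf{T}_n$: $T\le_D S$ iff there is a sequence $T=P_1,\dots,P_k=S$ in $\mathbf{T}_n$ such that for each $1\le j<k$ there are $w\in\mathcal{C}_{P_j}$, $y\in\mathcal{C}_{P_{j+1}}$ with $w\le_D y$. *)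

theory Defs
  imports Main "HOL-Combinatorics.Multiset_Permutations"
begin

text \<open>
  A filling of a Young diagram is the list of its columns, from left to right, each column being
  read from top to bottom. The box in column \<open>c\<close> and row \<open>r\<close> (both counted from 0) contains
  \<open>T ! c ! r\<close>. Columns are nonempty, so the representation of a tableau is unique.
\<close>

type_synonym tableau = "nat list list"

definition entries :: "tableau \<Rightarrow> nat set" where
  "entries T = set (concat T)"

definition shape :: "tableau \<Rightarrow> nat list" where
  "shape T = map length T"

definition young_tableau :: "tableau \<Rightarrow> bool" where
  "young_tableau T \<longleftrightarrow>
     [] \<notin> set T \<and> sorted_wrt (\<ge>) (shape T) \<and>
     0 \<notin> entries T \<and> distinct (concat T) \<and>
     (\<forall>C\<in>set T. sorted_wrt (<) C) \<and>
     (\<forall>c r. Suc c < length T \<and> r < length (T ! Suc c) \<longrightarrow> T ! c ! r < T ! Suc c ! r)"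

definition standard_tableaux :: "nat \<Rightarrow> tableau set" where
  "standard_tableaux n = {T. young_tableau T \<and> entries T = {1..n}}"

definition standard_tableaux2 :: "nat \<Rightarrow> tableau set" where
  "standard_tableaux2 n = {T \<in> standard_tableaux n. length T \<le> 2}"

subsection \<open>Dominance order on lists of column lengths\<close>

definition dominance_le :: "nat list \<Rightarrow> nat list \<Rightarrow> bool" where
  "dominance_le \<mu> \<nu> \<longleftrightarrow>
     (\<forall>i. i \<le> length \<mu> \<and> i \<le> length \<nu> \<longrightarrow> sum_list (take i \<mu>) \<le> sum_list (take i \<nu>))"

subsection \<open>Jeu de taquin\<close>

text \<open>
  The hole is the box in column \<open>c\<close> and row \<open>r\<close>; the value stored there is irrelevant. When the
  hole has reached an outer corner it is the last box of its column; if this column thereby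
  becomes empty, the column is dropped.
\<close>

function slide :: "nat \<Rightarrow> nat \<Rightarrow> tableau \<Rightarrow> tableau" where
  "slide c r T =
     (let right = (Suc c < length T \<and> r < length (T ! Suc c));
          below = (c < length T \<and> Suc r < length (T ! c))
      in if right \<and> (below \<longrightarrow> T ! Suc c ! r < T ! c ! Suc r)
         then slide (Suc c) r (T[c := (T ! c)[r := T ! Suc c ! r]])
         else if below
         then slide c (Suc r) (T[c := (T ! c)[r := T ! c ! Suc r]])
         else filter (\<lambda>C. C \<noteq> []) (T[c := butlast (T ! c)]))"
  by pat_completeness auto
termination
  by (relation "measures [\<lambda>(c, r, T). length T - c, \<lambda>(c, r, T). length (T ! c) - r]") auto

declare slide.simps [simp del]

definition box_of :: "nat \<Rightarrow> tableau \<Rightarrow> nat \<times> nat" where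
  "box_of x T = (THE (c, r). c < length T \<and> r < length (T ! c) \<and> T ! c ! r = x)"

definition remove_entry :: "nat \<Rightarrow> tableau \<Rightarrow> tableau" where
  "remove_entry x T = (case box_of x T of (c, r) \<Rightarrow> slide c r T)"

text \<open>
  With entries \<open>m\<^sub>1 < \<dots> < m\<^sub>n\<close>, the entries \<open>m\<^sub>1, \<dots>, m\<^sub>i\<^sub>-\<^sub>1\<close> and \<open>m\<^sub>j\<^sub>+\<^sub>1, \<dots>, m\<^sub>n\<close> are removed one
  after the other, in increasing order; the result does not depend on the order of removals.
\<close>

definition projection :: "nat \<Rightarrow> nat \<Rightarrow> tableau \<Rightarrow> tableau" where
  "projection i j T =
     (let m = sorted_list_of_set (entries T)
      in fold remove_entry (take (i - 1) m @ drop j m) T)"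

definition chain_le :: "nat \<Rightarrow> tableau \<Rightarrow> tableau \<Rightarrow> bool" where
  "chain_le n T S \<longleftrightarrow>
     (\<forall>i j. 1 \<le> i \<and> i < j \<and> j \<le> n \<longrightarrow>
        dominance_le (shape (projection i j T)) (shape (projection i j S)))"

subsection \<open>Right weak order and the induced Duflo order\<close>

definition position :: "nat list \<Rightarrow> nat \<Rightarrow> nat" where
  "position w i = (THE k. k < length w \<and> w ! k = i)"

text \<open>To be used for arrangements \<open>w\<close> and \<open>y\<close> of \<open>{1..n}\<close>.\<close>

definition right_weak_le :: "nat \<Rightarrow> nat list \<Rightarrow> nat list \<Rightarrow> bool" where
  "right_weak_le n w y \<longleftrightarrow>
     (\<forall>i j. 1 \<le> i \<and> i < j \<and> j \<le> n \<longrightarrow>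
        position w j < position w i \<longrightarrow> position y j < position y i)"

fun column_insert :: "nat \<Rightarrow> tableau \<Rightarrow> tableau" where
  "column_insert j [] = [[j]]"
| "column_insert j (C # Cs) =
     (if \<exists>x\<in>set C. j < x
      then let b = Min {x \<in> set C. j < x}
           in map (\<lambda>x. if x = b then j else x) C # column_insert b Cs
      else (C @ [j]) # Cs)"

definition tableau_of_word :: "nat list \<Rightarrow> tableau" where
  "tableau_of_word w = foldr column_insert w []"

definition word_class :: "nat \<Rightarrow> tableau \<Rightarrow> nat list set" where
  "word_class n T = {w \<in> permutations_of_set {1..n}. tableau_of_word w = T}"

definition duflo_le :: "nat \<Rightarrow> tableau \<Rightarrow> tableau \<Rightarrow> bool" where
  "duflo_le n T S \<longleftrightarrow>
     (\<exists>(P :: nat \<Rightarrow> tableau) k. 1 \<le> k \<and> P 1 = T \<and> P k = S \<and>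
        (\<forall>j. 1 \<le> j \<and> j \<le> k \<longrightarrow> P j \<in> standard_tableaux n) \<and>
        (\<forall>j. 1 \<le> j \<and> j < k \<longrightarrow>
           (\<exists>w\<in>word_class n (P j). \<exists>y\<in>word_class n (P (Suc j)). right_weak_le n w y)))"

end

theory Submission
  imports Defs
begin

text \<open>
  A tableau with at most two columns is a pair \<open>(A, B)\<close> of sets satisfying the ballot condition.
  For a window \<open>[i, j)\<close> and a cut \<open>t\<close> in it let \<open>cut_size\<close> be
  \<open>|A \<inter> [t, j)| + |B \<inter> [i, t)|\<close>, the length of a decreasing subsequence of the reading word; its
  maximum over \<open>t\<close> is preserved by jeu de taquin removals outside the window and equals \<open>|A|\<close> once
  only the window is left. Hence the chain order compares these maxima in all windows. They are also
  the lengths of the longest decreasing subsequences of any word of the tableau restricted to the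
  window, so they grow along the weak order; moreover having at most two columns means having no
  increasing subsequence of length 3, so a Duflo chain starting at two columns never leaves them.

  Conversely, match each entry of \<open>B\<close> with an entry of \<open>A\<close> like a closing with an opening
  parenthesis. If \<open>T\<close> is below \<open>S\<close> in the chain order, then every arc of \<open>S\<close> is one of \<open>T\<close>. The
  largest entry of the second column of \<open>T\<close> that is not in that of \<open>S\<close> closes an outermost arc, and
  moving it to the first column is one step of the weak order on suitable words.
\<close>

subsection \<open>Two-column tableaux as ballot pairs\<close>

text \<open>Dropping empty columns gives the normal form demanded by \<open>young_tableau\<close>.
  The price is that \<open>tab {} B\<close> and \<open>tab B {}\<close> coincide, whence the
  recurring side condition \<open>A = {} \<longrightarrow> B = {}\<close>, which
  \<open>ballot\<close> implies.\<close>

definition tab :: "nat set \<Rightarrow> nat set \<Rightarrow> tableau" where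
  "tab A B = filter (\<lambda>C. C \<noteq> []) [sorted_list_of_set A, sorted_list_of_set B]"

text \<open>The row condition of a two-column tableau in counting form: reading the entries in
  increasing order, with \<open>A\<close> as opening and \<open>B\<close> as closing parentheses, no
  initial segment has an excess of closing ones.\<close>

definition ballot :: "nat set \<Rightarrow> nat set \<Rightarrow> bool" where
  "ballot A B \<longleftrightarrow> finite A \<and> finite B \<and> A \<inter> B = {} \<and>
     (\<forall>t. card (B \<inter> {..t}) \<le> card (A \<inter> {..t}))"

lemma sorted_list_of_set_unique:
  assumes "sorted_wrt (<) xs" "set xs = (A :: nat set)"
  shows "sorted_list_of_set A = xs"
  using assms sorted_list_of_set.idem_if_sorted_distinct strict_sorted_iff by blast

lemma Nil_eq_sorted_list_of_set: "finite A \<Longrightarrow> [] = sorted_list_of_set A \<longleftrightarrow> A = {}"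
  by (metis sorted_list_of_set.sorted_key_list_of_set_eq_Nil_iff)

lemma card_set_Int:
  assumes "distinct xs"
  shows "card (set xs \<inter> I) = card {k. k < length xs \<and> xs ! k \<in> I}"
proof -
  have "bij_betw ((!) xs) {k. k < length xs \<and> xs ! k \<in> I} (set xs \<inter> I)"
    using assms by (auto simp: bij_betw_def inj_on_def nth_eq_iff_index_eq in_set_conv_nth)
  then show ?thesis by (simp add: bij_betw_same_card)
qed

text \<open>Counts are compared by sending an entry to the one with the same index in the other
  list, that is, along the rows of a tableau.\<close>

lemma card_set_Int_le:
  assumes "distinct xs" "distinct ys"
    and "\<And>k. k < length xs \<Longrightarrow> xs ! k \<in> I \<Longrightarrow> k < length ys \<and> ys ! k \<in> J"
  shows "card (set xs \<inter> I) \<le> card (set ys \<inter> J)"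
  unfolding card_set_Int[OF assms(1)] card_set_Int[OF assms(2)]
  using assms(3) by (intro card_mono) auto

lemma card_insert_Int:
  assumes "finite A" "x \<notin> A"
  shows "card (insert x A \<inter> I) = card (A \<inter> I) + of_bool (x \<in> I)"
  using assms by (simp add: Int_insert_left)

lemma card_Diff_Int:
  assumes "finite A" "x \<in> A"
  shows "card (A \<inter> I) = card ((A - {x}) \<inter> I) + of_bool (x \<in> I)"
  using card_insert_Int[of "A - {x}" x I] assms by (simp add: insert_absorb)

lemma strict_sorted_nth_less_iff:
  assumes "sorted_wrt (<) (xs :: nat list)" "i < length xs" "j < length xs"
  shows "xs ! i < xs ! j \<longleftrightarrow> i < j"
  using assms by (metis linorder_less_linear not_less_iff_gr_or_eq sorted_wrt_nth_less)

lemma ballot_if_rows: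
  assumes "sorted_wrt (<) as" "sorted_wrt (<) bs" "set as \<inter> set bs = {}"
    and "\<And>k. k < length bs \<Longrightarrow> k < length as \<and> as ! k < bs ! k"
  shows "ballot (set as) (set bs)"
proof -
  have "distinct as" "distinct bs"
    using assms strict_sorted_iff by auto
  then show ?thesis
    unfolding ballot_def using assms(3,4)
    by (auto intro!: card_set_Int_le dest: order.strict_trans1)
       (meson dual_order.trans less_imp_le)
qed

text \<open>In a sorted list the indices of the entries up to \<open>t\<close> form an initial
  segment, whose length is the count on the left. This translates between the row and the counting
  form of the tableau condition.\<close>

lemma nth_le_iff_card:
  assumes "sorted_wrt (<) xs" "finite A" "set xs = (A :: nat set)"
  shows "k < card (A \<inter> {..t}) \<longleftrightarrow> k < length xs \<and> xs ! k \<le> t"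
proof -
  have d: "distinct xs" using assms strict_sorted_iff by auto
  let ?K = "{k. k < length xs \<and> xs ! k \<in> {..t}}"
  have c: "card (A \<inter> {..t}) = card ?K" using card_set_Int[OF d] assms(3) by auto
  have dc: "l \<in> ?K" if "k \<in> ?K" "l \<le> k" for k l
    using that strict_sorted_nth_less_iff[OF assms(1), of l k]
    by (cases "l = k") (auto intro: less_imp_le dest: order.strict_trans2)
  have "?K = {..<card ?K}"
  proof (cases "?K = {}")
    case False
    have fin: "finite ?K" by simp
    have "?K = {..Max ?K}"
      using dc[OF Max_in[OF fin False]] Max_ge[OF fin] by blast
    then show ?thesis by (metis card_atMost lessThan_Suc_atMost)
  next
    case True
    show ?thesis unfolding True by simp
  qed
  then have "k \<in> ?K \<longleftrightarrow> k \<in> {..<card ?K}" by (rule arg_cong)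
  then show ?thesis using c by simp
qed

text \<open>The ballot inequality is applied at the threshold given by the \<open>k\<close>-th entry
  of \<open>B\<close>: at least \<open>k + 1\<close> entries of \<open>A\<close> lie up to it, and
  disjointness makes the comparison strict.\<close>

lemma rows_if_ballot:
  assumes "ballot A B" "k < card B"
  shows "k < card A \<and> sorted_list_of_set A ! k < sorted_list_of_set B ! k"
proof -
  let ?as = "sorted_list_of_set A" and ?bs = "sorted_list_of_set B"
  have fin: "finite A" "finite B" and disj: "A \<inter> B = {}"
    and bal: "card (B \<inter> {..?bs ! k}) \<le> card (A \<inter> {..?bs ! k})"
    using assms(1) by (auto simp: ballot_def)
  have "k < card (B \<inter> {..?bs ! k})"
    using nth_le_iff_card[of ?bs B k "?bs ! k"] fin assms(2) by simp
  then have "k < card (A \<inter> {..?bs ! k})" using bal by simp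
  then have "k < card A" "?as ! k \<le> ?bs ! k"
    using nth_le_iff_card[of ?as A k "?bs ! k"] fin by auto
  moreover have "?as ! k \<noteq> ?bs ! k"
    using disj fin calculation(1) assms(2)
    by (metis disjoint_iff nth_mem sorted_list_of_set.length_sorted_key_list_of_set sorted_list_of_set.set_sorted_key_list_of_set)
  ultimately show ?thesis by simp
qed

lemma ballot_card_le:
  assumes "ballot A B"
  shows "card B \<le> card A"
  using rows_if_ballot[OF assms] by (meson linorder_not_le order_less_irrefl)

lemma tab_simps:
  assumes "finite A" "finite B"
  shows "A \<noteq> {} \<Longrightarrow> B \<noteq> {} \<Longrightarrow> tab A B = [sorted_list_of_set A, sorted_list_of_set B]"
    and "A \<noteq> {} \<Longrightarrow> tab A {} = [sorted_list_of_set A]"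
    and "tab {} {} = []"
  using assms by (auto simp: tab_def)

lemma tab_inj:
  assumes "tab A B = tab A' B'" "finite A" "finite B" "finite A'" "finite B'"
    and "A = {} \<Longrightarrow> B = {}" "A' = {} \<Longrightarrow> B' = {}"
  shows "A = A' \<and> B = B'"
  using assms unfolding tab_def
  by (auto split: if_splits) (metis sorted_list_of_set.set_sorted_key_list_of_set)+

lemma ballot_empty: "ballot {} B \<Longrightarrow> B = {}"
  using ballot_card_le[of "{}" B] by (auto simp: ballot_def)

lemma entries_tab:
  assumes "finite A" "finite B"
  shows "entries (tab A B) = A \<union> B"
  using assms by (auto simp: tab_def entries_def)

lemma length_tab: "length (tab A B) \<le> 2"
  by (simp add: tab_def)

lemma tab_in_standard_tableaux:
  assumes "ballot A B" "A \<union> B = {1..n}"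
  shows "tab A B \<in> standard_tableaux n"
proof -
  have fin: "finite A" "finite B" and disj: "A \<inter> B = {}"
    using assms(1) by (auto simp: ballot_def)
  have 0: "0 \<notin> A \<union> B" using assms(2) by simp
  have ent: "entries (tab A B) = {1..n}" using entries_tab[OF fin] assms(2) by simp
  consider "A = {}" "B = {}" | "A \<noteq> {}" "B = {}" | "A \<noteq> {}" "B \<noteq> {}"
    using ballot_empty assms(1) by blast
  then have "young_tableau (tab A B)"
  proof cases
    case 1
    then show ?thesis using ent by (auto simp: tab_def young_tableau_def shape_def entries_def)
  next
    case 2
    then show ?thesis using ent fin
      by (auto simp: tab_simps young_tableau_def shape_def Nil_eq_sorted_list_of_set)
  next
    case 3
    then show ?thesis using ent fin disj rows_if_ballot[OF assms(1)] ballot_card_le[OF assms(1)]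
      by (auto simp: tab_simps young_tableau_def shape_def less_Suc_eq Nil_eq_sorted_list_of_set)
  qed
  then show ?thesis using ent by (simp add: standard_tableaux_def)
qed

lemma young_tableau_two_columns:
  assumes "young_tableau T" "length T \<le> 2"
  obtains A B where "T = tab A B" "ballot A B" "entries T = A \<union> B"
proof -
  consider "T = []" | as where "T = [as]" | as bs where "T = [as, bs]"
    using assms(2) by (cases T rule: remdups_adj.cases) auto
  then show thesis
  proof cases
    case 1
    then show ?thesis
      by (intro that[of "{}" "{}"]) (auto simp: tab_def ballot_def entries_def)
  next
    case (2 as)
    then have "sorted_wrt (<) as" "as \<noteq> []"
      using assms(1) by (auto simp: young_tableau_def)
    then show ?thesis using 2
      by (intro that[of "set as" "{}"])
         (auto simp: tab_def ballot_def entries_def sorted_list_of_set_unique)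
  next
    case (3 as bs)
    then have yt: "sorted_wrt (<) as" "as \<noteq> []" "sorted_wrt (<) bs" "bs \<noteq> []"
      "set as \<inter> set bs = {}" "length bs \<le> length as"
      "\<And>k. k < length bs \<Longrightarrow> as ! k < bs ! k"
      using assms(1) by (auto simp: young_tableau_def shape_def)
    then have "ballot (set as) (set bs)" by (intro ballot_if_rows) auto
    then show ?thesis using 3 yt
      by (intro that[of "set as" "set bs"])
         (auto simp: tab_def entries_def sorted_list_of_set_unique)
  qed
qed

subsection \<open>Jeu de taquin on two columns\<close>

definition cut_size :: "nat set \<Rightarrow> nat set \<Rightarrow> nat \<Rightarrow> nat \<Rightarrow> nat \<Rightarrow> nat" where
  "cut_size A B i j t = card (A \<inter> {t..<j}) + card (B \<inter> {i..<t})"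

text \<open>Comparison of the maxima of \<open>cut_size\<close> over all cuts of the half-open
  window, phrased with witnesses so that no maximum has to be formed.\<close>

definition cuts_le ::
  "nat set \<Rightarrow> nat set \<Rightarrow> nat set \<Rightarrow> nat set \<Rightarrow> nat \<Rightarrow> nat \<Rightarrow> bool" where
  "cuts_le A B A' B' i j \<longleftrightarrow>
     (\<forall>t\<in>{i..j}. \<exists>t'\<in>{i..j}. cut_size A B i j t \<le> cut_size A' B' i j t')"

lemma cuts_le_refl: "cuts_le A B A B i j"
  by (auto simp: cuts_le_def)

lemma cuts_le_trans:
  "cuts_le A B A' B' i j \<Longrightarrow> cuts_le A' B' A'' B'' i j \<Longrightarrow> cuts_le A B A'' B'' i j"
  unfolding cuts_le_def by (meson order_trans)

text \<open>With no column to the right the hole can only sink to the bottom, which amounts to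
  deleting the entry.\<close>

lemma slide_last_column:
  assumes "Suc c = length T" "r < length (T ! c)"
  shows "slide c r T =
    filter (\<lambda>C. C \<noteq> []) (T[c := take r (T ! c) @ drop (Suc r) (T ! c)])"
  using assms
proof (induction "length (T ! c) - r" arbitrary: r T)
  case 0
  then show ?case by simp
next
  case (Suc m)
  show ?case
  proof (cases "Suc r < length (T ! c)")
    case True
    let ?C = "(T ! c)[r := T ! c ! Suc r]"
    have c: "c < length T" using Suc.prems by simp
    have "slide c r T = slide c (Suc r) (T[c := ?C])"
      using True Suc.prems by (subst slide.simps) auto
    also have "\<dots> = filter (\<lambda>C. C \<noteq> []) (T[c := take (Suc r) ?C @ drop (Suc (Suc r)) ?C])"
      using Suc.hyps(1)[of "T[c := ?C]" "Suc r"] Suc.hyps(2) Suc.prems True c by simp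
    also have "take (Suc r) ?C @ drop (Suc (Suc r)) ?C = take r (T ! c) @ drop (Suc r) (T ! c)"
      using True Suc.prems by (simp add: take_Suc_conv_app_nth Cons_nth_drop_Suc)
    finally show ?thesis .
  next
    case False
    then have "length (T ! c) = Suc r" using Suc.prems by simp
    then show ?thesis
      using Suc.prems by (subst slide.simps) (auto simp: butlast_conv_take)
  qed
qed

text \<open>Here \<open>cs\<close> is the first column without the hole, and the value
  \<open>z\<close> in the hole is arbitrary, as the induction needs. Either the hole sinks to the
  bottom, or in row \<open>s\<close> it crosses over and \<open>bs ! s\<close> is pulled into the
  first column. The inequalities record the comparisons made on the way; they yield the row
  conditions afterwards.\<close>

lemma slide_first_column:
  fixes cs bs :: "nat list"
  assumes "r \<le> length cs" "length bs \<le> Suc (length cs)" "set cs \<inter> set bs = {}"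
  shows "(slide 0 r [take r cs @ z # drop r cs, bs] = filter (\<lambda>C. C \<noteq> []) [cs, bs] \<and>
      length bs \<le> length cs \<and> (\<forall>k. r \<le> k \<and> k < length bs \<longrightarrow> cs ! k < bs ! k)) \<or>
    (\<exists>s. r \<le> s \<and> s < length bs \<and> s \<le> length cs \<and> (s < length cs \<longrightarrow> bs ! s < cs ! s) \<and>
      (\<forall>k. r \<le> k \<and> k < s \<longrightarrow> cs ! k < bs ! k) \<and>
      slide 0 r [take r cs @ z # drop r cs, bs] = filter (\<lambda>C. C \<noteq> [])
        [take s cs @ bs ! s # drop s cs, take s bs @ drop (Suc s) bs])"
    (is "?stay r z \<or> (\<exists>s. ?move r z s)")
  using assms(1)
proof (induction "length cs - r" arbitrary: r z rule: less_induct)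
  case less
  note r = \<open>r \<le> length cs\<close>
  have min: "min (length cs) r = r" using r by simp
  have nth: "(take r cs @ z # drop r cs) ! Suc r = cs ! r" if "r < length cs"
    using that by (simp add: nth_append min Suc_diff_le)
  have upd: "(take r cs @ z # drop r cs)[r := y] = take r cs @ y # drop r cs" for y
    by (simp add: list_update_append min)
  show ?case
  proof (cases "r < length bs \<and> (r < length cs \<longrightarrow> bs ! r < cs ! r)")
    case True
    then have "slide 0 r [take r cs @ z # drop r cs, bs]
        = slide 1 r [take r cs @ bs ! r # drop r cs, bs]"
      using nth upd r by (subst slide.simps) auto
    also have "\<dots> = filter (\<lambda>C. C \<noteq> [])
        [take r cs @ bs ! r # drop r cs, take r bs @ drop (Suc r) bs]"
      using True by (subst slide_last_column) auto
    finally have "?move r z r" using True r by simp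
    then show ?thesis by blast
  next
    case no_right: False
    show ?thesis
    proof (cases "r < length cs")
      case True
      have cmp: "cs ! r < bs ! r" if "r < length bs"
        using no_right True that assms(3)
        by (metis disjoint_iff linorder_neqE_nat nth_mem)
      have "slide 0 r [take r cs @ z # drop r cs, bs]
          = slide 0 (Suc r) [take r cs @ cs ! r # drop r cs, bs]"
        using nth upd no_right True by (subst slide.simps) auto
      \<comment> \<open>Positions \<open>r\<close> and \<open>Suc r\<close> now both hold
        \<open>cs ! r\<close>; the second is the new hole, and its stale value plays the role of
        \<open>z\<close>.\<close>
      also have "take r cs @ cs ! r # drop r cs = take (Suc r) cs @ cs ! r # drop (Suc r) cs"
        using True by (simp add: take_Suc_conv_app_nth Cons_nth_drop_Suc)
      finally have eq: "slide 0 r [take r cs @ z # drop r cs, bs]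
          = slide 0 (Suc r) [take (Suc r) cs @ cs ! r # drop (Suc r) cs, bs]" .
      have "length cs - Suc r < length cs - r" "Suc r \<le> length cs" using True by auto
      from less.hyps[OF this, of "cs ! r"] show ?thesis
      proof (elim disjE exE)
        assume "?stay (Suc r) (cs ! r)"
        then have "?stay r z" unfolding eq using cmp by (metis Suc_leI le_neq_implies_less)
        then show ?thesis by blast
      next
        fix s assume s: "?move (Suc r) (cs ! r) s"
        then have "\<forall>k. r \<le> k \<and> k < s \<longrightarrow> cs ! k < bs ! k"
          using cmp by (metis Suc_leI le_neq_implies_less less_trans)
        then have "?move r z s" unfolding eq using s by simp
        then show ?thesis by blast
      qed
    next
      case False
      then have "r = length cs" "length bs \<le> r" using r no_right by auto
      then have "?stay r z" by (subst slide.simps) auto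
      then show ?thesis by blast
    qed
  qed
qed

lemma card_Int_split:
  fixes a b c :: nat
  assumes "finite A" "a \<le> b" "b \<le> c"
  shows "card (A \<inter> {a..<c}) = card (A \<inter> {a..<b}) + card (A \<inter> {b..<c})"
proof -
  have "A \<inter> {a..<c} = (A \<inter> {a..<b}) \<union> (A \<inter> {b..<c})" using assms by auto
  then show ?thesis using assms by (simp add: card_Un_disjoint disjoint_iff)
qed

lemma card_Int_singleton: "card (A \<inter> {a..<Suc a}) = of_bool (a \<in> A)"
proof -
  have "A \<inter> {a..<Suc a} = (if a \<in> A then {a} else {})" by auto
  then show ?thesis by simp
qed

lemma cut_size_Diff:
  assumes "x \<notin> {i..<j}" "t \<in> {i..j}"
  shows "cut_size (A - {x}) (B - {x}) i j t = cut_size A B i j t"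
proof -
  have "(A - {x}) \<inter> {t..<j} = A \<inter> {t..<j}" "(B - {x}) \<inter> {i..<t} = B \<inter> {i..<t}"
    using assms by auto
  then show ?thesis by (simp add: cut_size_def)
qed

text \<open>This is the effect of a slide that pulls \<open>e\<close> across. Outside
  \<open>x\<close>, only the side of \<open>e\<close> changes: within the window, a cut
  \<open>t \<le> e\<close> gains 1 and a cut \<open>t > e\<close> loses 1. A loss is made good by
  moving the cut to \<open>e\<close>, a gain is matched in the old pair by moving it to
  \<open>Suc e\<close>; \<open>after\<close> and \<open>before\<close> bound the cost of these
  shifts.\<close>

lemma cuts_le_move:
  assumes fin: "finite A" "finite B" and disj: "A \<inter> B = {}"
    and x: "x \<in> A" and e: "e \<in> B" and xe: "x < e"
    and before: "\<And>u. x < u \<Longrightarrow> u \<le> e \<Longrightarrow> card (A \<inter> {u..<e}) \<le> card (B \<inter> {u..<e})"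
    and after: "\<And>u. card (B \<inter> {Suc e..<u}) \<le> card (A \<inter> {Suc e..<u})"
    and ij: "x \<notin> {i..<j}"
  shows "cuts_le A B (insert e (A - {x})) (B - {e}) i j"
    and "cuts_le (insert e (A - {x})) (B - {e}) A B i j"
proof -
  let ?A = "insert e (A - {x})" and ?B = "B - {e}"
  have eA: "e \<notin> A" using e disj by auto
  have move: "cut_size ?A ?B i j t + of_bool (e \<in> {i..<t}) = cut_size A B i j t + of_bool (e \<in> {t..<j})"
    if "t \<in> {i..j}" for t
  proof -
    have "card (?A \<inter> {t..<j}) = card ((A - {x}) \<inter> {t..<j}) + of_bool (e \<in> {t..<j})"
      using fin eA by (intro card_insert_Int) auto
    moreover have "card (A \<inter> {t..<j}) = card ((A - {x}) \<inter> {t..<j})"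
      using card_Diff_Int[OF fin(1) x, of "{t..<j}"] ij that by auto
    ultimately show ?thesis using card_Diff_Int[OF fin(2) e, of "{i..<t}"]
      by (simp add: cut_size_def)
  qed
  note splitA = card_Int_split[OF fin(1)] and splitB = card_Int_split[OF fin(2)]
  have "\<exists>t'\<in>{i..j}. cut_size A B i j t \<le> cut_size ?A ?B i j t'" if t: "t \<in> {i..j}" for t
  proof (cases "i \<le> e \<and> e < t")
    case True
    have "cut_size A B i j t \<le> cut_size A B i j e + 1"
      unfolding cut_size_def
      using splitA[of e t j] splitA[of e "Suc e" t] splitB[of i e t] splitB[of e "Suc e" t]
        card_Int_singleton[of A e] card_Int_singleton[of B e] after[of t] True t eA by simp
    also have "\<dots> = cut_size ?A ?B i j e" using move[of e] True t by simp
    finally show ?thesis using True t by (intro bexI[of _ e]) auto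
  next
    case False
    then show ?thesis using move[OF t] t by (intro bexI[of _ t]) auto
  qed
  then show "cuts_le A B ?A ?B i j" by (simp add: cuts_le_def)
  have "\<exists>t'\<in>{i..j}. cut_size ?A ?B i j t \<le> cut_size A B i j t'" if t: "t \<in> {i..j}" for t
  proof (cases "t \<le> e \<and> e < j")
    case True
    \<comment> \<open>Since \<open>x < e < j\<close> and \<open>x\<close> is outside the window,
      \<open>x\<close> lies below the whole window.\<close>
    then have "x < t" using ij xe t by auto
    have "cut_size ?A ?B i j t = cut_size A B i j t + 1" using move[OF t] True by simp
    also have "\<dots> \<le> cut_size A B i j (Suc e)"
      unfolding cut_size_def
      using splitA[of t e j] splitA[of e "Suc e" j] splitB[of i t "Suc e"] splitB[of t e "Suc e"]
        card_Int_singleton[of A e] card_Int_singleton[of B e] before[OF \<open>x < t\<close>] True t eA e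
      by simp
    finally show ?thesis using True t by (intro bexI[of _ "Suc e"]) auto
  next
    case False
    then show ?thesis using move[OF t] t by (intro bexI[of _ t]) auto
  qed
  then show "cuts_le ?A ?B A B i j" by (simp add: cuts_le_def)
qed

section \<open>Removal of entries and projections\<close>

lemma box_of_eq:
  assumes "distinct (concat T)" "length T \<le> 2" "c < length T" "r < length (T ! c)"
  shows "box_of (T ! c ! r) T = (c, r)"
proof -
  have "c' = c \<and> r' = r"
    if "c' < length T" "r' < length (T ! c')" "T ! c' ! r' = T ! c ! r" for c' r'
  proof -
    consider as where "T = [as]" | as bs where "T = [as, bs]"
      using assms(2,3) by (cases T rule: remdups_adj.cases) auto
    then show ?thesis
      using assms that
      by cases (auto simp: less_Suc_eq nth_eq_iff_index_eq disjoint_iff, (metis nth_mem)+)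
  qed
  then show ?thesis unfolding box_of_def using assms(3,4)
    by (intro the_equality) auto
qed

lemma remove_entry_nth:
  assumes "distinct (concat T)" "length T \<le> 2" "c < length T" "r < length (T ! c)"
  shows "remove_entry (T ! c ! r) T = slide c r T"
  using box_of_eq[OF assms] by (simp add: remove_entry_def)

lemma sorted_list_of_set_Diff:
  assumes "finite (A :: nat set)" "r < card A"
  shows "sorted_list_of_set (A - {sorted_list_of_set A ! r}) =
    take r (sorted_list_of_set A) @ drop (Suc r) (sorted_list_of_set A)"
proof (rule sorted_list_of_set_unique)
  let ?as = "sorted_list_of_set A"
  have as: "?as = take r ?as @ ?as ! r # drop (Suc r) ?as"
    using assms by (simp add: id_take_nth_drop)
  have sd: "sorted_wrt (<) ?as" "distinct ?as" by auto
  show "sorted_wrt (<) (take r ?as @ drop (Suc r) ?as)"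
    using sd(1) by (subst (asm) as) (simp add: sorted_wrt_append)
  have "set ?as = insert (?as ! r) (set (take r ?as @ drop (Suc r) ?as))"
    by (subst as) auto
  moreover have "?as ! r \<notin> set (take r ?as @ drop (Suc r) ?as)"
    using sd(2) by (subst (asm) as) auto
  ultimately show "set (take r ?as @ drop (Suc r) ?as) = A - {?as ! r}"
    using assms(1) by auto
qed

lemma ballot_mono:
  assumes "ballot A B" "finite A'" "B' \<subseteq> B" "A' \<inter> B' = {}" "A \<subseteq> A'"
  shows "ballot A' B'"
  unfolding ballot_def
proof (intro conjI allI)
  fix t
  have "card (B' \<inter> {..t}) \<le> card (B \<inter> {..t})" "card (A \<inter> {..t}) \<le> card (A' \<inter> {..t})"
    using assms by (auto simp: ballot_def intro!: card_mono)
  then show "card (B' \<inter> {..t}) \<le> card (A' \<inter> {..t})"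
    using assms(1) unfolding ballot_def by (meson order_trans)
qed (use assms in \<open>auto simp: ballot_def dest: finite_subset\<close>)

text \<open>Either \<open>x\<close> is simply deleted from its column, or \<open>x\<close> leaves
  the first column and one entry \<open>e\<close> of the second column takes its place there. The
  first outcome does not affect windows avoiding \<open>x\<close>, the second is
  \<open>cuts_le_move\<close>.\<close>

lemma remove_entry_tab:
  assumes bal: "ballot A B" and x: "x \<in> A \<union> B"
  shows "\<exists>A' B'. remove_entry x (tab A B) = tab A' B' \<and> ballot A' B' \<and>
    A' \<union> B' = A \<union> B - {x} \<and>
    (\<forall>i j. x \<notin> {i..<j} \<longrightarrow> cuts_le A B A' B' i j \<and> cuts_le A' B' A B i j)"
proof -
  have fin: "finite A" "finite B" and disj: "A \<inter> B = {}"
    using bal by (auto simp: ballot_def)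
  let ?as = "sorted_list_of_set A" and ?bs = "sorted_list_of_set B"
  have rows: "k < length ?as \<and> ?as ! k < ?bs ! k" if "k < length ?bs" for k
    using rows_if_ballot[OF bal, of k] that by simp
  \<comment> \<open>This settles all outcomes in which no entry changes its column.\<close>
  have just_delete: ?thesis
    if "remove_entry x (tab A B) = tab (A - {x}) (B - {x})" "ballot (A - {x}) (B - {x})"
    using that cut_size_Diff[of x]
    by (intro exI[of _ "A - {x}"] exI[of _ "B - {x}"]) (auto simp: cuts_le_def)
  show ?thesis
  proof (cases "x \<in> B")
    case True
    then have ne: "A \<noteq> {}" "B \<noteq> {}" using ballot_empty bal by auto
    obtain r where r: "r < length ?bs" "x = ?bs ! r"
      using True fin by (metis in_set_conv_nth sorted_list_of_set.set_sorted_key_list_of_set)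
    have xA: "A - {x} = A" using True disj by auto
    have "remove_entry x (tab A B) = slide 1 r [?as, ?bs]"
      using remove_entry_nth[of "[?as, ?bs]" 1 r] r ne fin disj by (simp add: tab_simps)
    also have "\<dots> = tab (A - {x}) (B - {x})"
      using r sorted_list_of_set_Diff[of B r] fin xA
      by (subst slide_last_column) (auto simp: tab_def)
    finally show ?thesis
      using ballot_mono[OF bal, of A "B - {x}"] fin disj xA by (intro just_delete) auto
  next
    case xB: False
    then have xA: "x \<in> A" and xB': "B - {x} = B" and ne: "A \<noteq> {}" using x by auto
    obtain r where r: "r < length ?as" "x = ?as ! r"
      using xA fin by (metis in_set_conv_nth sorted_list_of_set.set_sorted_key_list_of_set)
    show ?thesis
    proof (cases "B = {}")
      case True
      have "remove_entry x (tab A B) = slide 0 r [?as]"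
        using remove_entry_nth[of "[?as]" 0 r] r fin ne True by (simp add: tab_simps)
      also have "\<dots> = tab (A - {x}) (B - {x})"
        using r sorted_list_of_set_Diff[of A r] fin True
        by (subst slide_last_column) (auto simp: tab_def)
      finally show ?thesis
        using True fin by (intro just_delete) (auto simp: ballot_def)
    next
      case False
      \<comment> \<open>The first column once \<open>x\<close> is gone: from row \<open>r\<close> on
        its indices are shifted by one against \<open>?as\<close>.\<close>
      define cs where "cs = sorted_list_of_set (A - {x})"
      have cs: "cs = take r ?as @ drop (Suc r) ?as"
        using sorted_list_of_set_Diff[of A r] r fin by (simp add: cs_def)
      have set_cs: "set cs = A - {x}" and sd_cs: "sorted_wrt (<) cs" "distinct cs"
        using fin by (auto simp: cs_def)
      have len_cs: "Suc (length cs) = length ?as" using r by (simp add: cs)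
      have cs_low: "cs ! k = ?as ! k" if "k < r" for k using that r by (simp add: cs nth_append)
      have cs_high: "cs ! k = ?as ! Suc k" if "r \<le> k" "k < length cs" for k
        using that r by (simp add: cs nth_append min_def)
      have as: "?as = take r cs @ x # drop r cs"
        using r by (simp add: cs id_take_nth_drop min_def)
      have "remove_entry x (tab A B) = slide 0 r [?as, ?bs]"
        using remove_entry_nth[of "[?as, ?bs]" 0 r] r False ne fin disj by (simp add: tab_simps)
      then have rem: "remove_entry x (tab A B) = slide 0 r [take r cs @ x # drop r cs, ?bs]"
        using as by simp
      have "r \<le> length cs" "length ?bs \<le> Suc (length cs)" "set cs \<inter> set ?bs = {}"
        using len_cs r ballot_card_le[OF bal] disj fin by (auto simp: set_cs)
      from slide_first_column[OF this, of x] show ?thesis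
      proof (elim disjE exE conjE)
        assume stay: "slide 0 r [take r cs @ x # drop r cs, ?bs] = filter (\<lambda>C. C \<noteq> []) [cs, ?bs]"
          and len: "length ?bs \<le> length cs"
          and above: "\<forall>k. r \<le> k \<and> k < length ?bs \<longrightarrow> cs ! k < ?bs ! k"
        have "k < length cs \<and> cs ! k < ?bs ! k" if "k < length ?bs" for k
          using that len above rows[of k] cs_low[of k] by (cases "k < r") auto
        then have "ballot (set cs) (set ?bs)"
          using sd_cs fin disj set_cs by (intro ballot_if_rows) auto
        then show ?thesis
          using rem stay fin set_cs xB' by (intro just_delete) (auto simp: tab_def cs_def)
      next
        fix s
        assume s: "r \<le> s" "s < length ?bs" "s \<le> length cs" "s < length cs \<longrightarrow> ?bs ! s < cs ! s"
          and above: "\<forall>k. r \<le> k \<and> k < s \<longrightarrow> cs ! k < ?bs ! k"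
          and move: "slide 0 r [take r cs @ x # drop r cs, ?bs] = filter (\<lambda>C. C \<noteq> [])
            [take s cs @ ?bs ! s # drop s cs, take s ?bs @ drop (Suc s) ?bs]"
        define e where "e = ?bs ! s"
        have e: "e \<in> B" using s(2) fin unfolding e_def
          by (metis nth_mem sorted_list_of_set.set_sorted_key_list_of_set)
        have eA: "e \<notin> A" using e disj by auto
        have lt_bs: "?bs ! k < e \<longleftrightarrow> k < s" "e < ?bs ! k \<longleftrightarrow> s < k" if "k < length ?bs" for k
          using that s(2) strict_sorted_nth_less_iff[of ?bs] by (auto simp: e_def)
        have "?as ! r \<le> ?as ! s"
          using s len_cs strict_sorted_nth_less_iff[of ?as r s] by (cases "r = s") auto
        then have xe: "x < e" using rows[OF s(2)] r by (simp add: e_def)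
        have cs_bs: "cs ! k < ?bs ! k" if "k < s" for k
          using that above rows[of k] cs_low[of k] s by (cases "k < r") auto
        have cs_ge: "e < cs ! k" if "s \<le> k" "k < length cs" for k
          using that s(4) strict_sorted_nth_less_iff[OF sd_cs(1), of s k]
          by (cases "s = k") (auto simp: e_def)
        have cs_lt: "cs ! k < e" if "k < s" for k
          using that cs_bs[OF that] lt_bs(1)[of k] s by auto
        have A': "sorted_list_of_set (insert e (A - {x})) = take s cs @ e # drop s cs"
        proof (rule sorted_list_of_set_unique)
          have "sorted_wrt (<) (take s cs @ drop s cs)" using sd_cs by simp
          moreover have "\<forall>y\<in>set (take s cs). y < e"
            using cs_lt by (auto simp: in_set_conv_nth)
          moreover have "\<forall>y\<in>set (drop s cs). e < y"
            using cs_ge by (auto simp: in_set_conv_nth)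
          ultimately show "sorted_wrt (<) (take s cs @ e # drop s cs)"
            by (simp only: sorted_wrt_append) auto
          have "set (take s cs) \<union> set (drop s cs) = A - {x}"
            using set_cs by (metis append_take_drop_id set_append)
          then show "set (take s cs @ e # drop s cs) = insert e (A - {x})" by auto
        qed
        have B': "sorted_list_of_set (B - {e}) = take s ?bs @ drop (Suc s) ?bs"
          using sorted_list_of_set_Diff[of B s] s fin by (simp add: e_def)
        have tab': "remove_entry x (tab A B) = tab (insert e (A - {x})) (B - {e})"
          using rem move by (simp add: tab_def A' B' flip: e_def)
        have bal': "ballot (insert e (A - {x})) (B - {e})"
          unfolding ballot_def
        proof (intro conjI allI)
          fix t
          show "card ((B - {e}) \<inter> {..t}) \<le> card (insert e (A - {x}) \<inter> {..t})"
          \<comment> \<open>From \<open>e\<close> on the first column has exchanged \<open>x\<close>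
            for \<open>e\<close>, both of which are counted. Below \<open>e\<close> only rows above
            \<open>s\<close> matter, and there \<open>cs_bs\<close> compares the columns row by
            row.\<close>
          proof (cases "e \<le> t")
            case True
            have "card (A \<inter> {..t}) \<le> card (insert e (A - {x}) \<inter> {..t})"
              using card_Diff_Int[OF fin(1) xA, of "{..t}"] eA fin True xe
                card_insert_Int[of "A - {x}" e "{..t}"] by simp
            moreover have "card ((B - {e}) \<inter> {..t}) \<le> card (B \<inter> {..t})"
              using fin by (intro card_mono) auto
            ultimately show ?thesis using bal unfolding ballot_def by (meson order_trans)
          next
            case False
            have "card (set ?bs \<inter> {..t}) \<le> card (set cs \<inter> {..t})"
            proof (rule card_set_Int_le)
              fix k assume k: "k < length ?bs" "?bs ! k \<in> {..t}"
              then have "k < s" using False lt_bs(1)[of k] by simp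
              then show "k < length cs \<and> cs ! k \<in> {..t}" using cs_bs[of k] k s by simp
            qed (use sd_cs in auto)
            moreover have "(B - {e}) \<inter> {..t} = B \<inter> {..t}"
              "insert e (A - {x}) \<inter> {..t} = (A - {x}) \<inter> {..t}" using False by auto
            ultimately show ?thesis using fin set_cs by simp
          qed
        qed (use fin disj in auto)
        \<comment> \<open>Entries of the first column in \<open>{u..<e}\<close> sit in rows above
          \<open>s\<close>. Their right neighbours are larger, but still smaller than
          \<open>e\<close>.\<close>
        have before: "card (A \<inter> {u..<e}) \<le> card (B \<inter> {u..<e})" if u: "x < u" "u \<le> e" for u
        proof -
          have "card (set cs \<inter> {u..<e}) \<le> card (set ?bs \<inter> {u..<e})"
          proof (rule card_set_Int_le)
            fix k assume k: "k < length cs" "cs ! k \<in> {u..<e}"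
            then have "k < s" using cs_ge[of k] by fastforce
            then show "k < length ?bs \<and> ?bs ! k \<in> {u..<e}"
              using cs_bs[of k] lt_bs(1)[of k] k s by simp
          qed (use sd_cs in auto)
          moreover have "(A - {x}) \<inter> {u..<e} = A \<inter> {u..<e}" using u by auto
          ultimately show ?thesis using fin set_cs by simp
        qed
        have after: "card (B \<inter> {Suc e..<u}) \<le> card (A \<inter> {Suc e..<u})" for u
        proof -
          have "card (set ?bs \<inter> {Suc e..<u}) \<le> card (set ?as \<inter> {Suc e..<u})"
          proof (rule card_set_Int_le)
            fix k assume k: "k < length ?bs" "?bs ! k \<in> {Suc e..<u}"
            then have "s < k" using lt_bs(2)[of k] by simp
            \<comment> \<open>An entry of the second column above \<open>e\<close> sits in a row
              \<open>k > s\<close>. Its left neighbour \<open>?as ! k\<close> is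
              \<open>cs ! l\<close>, which exceeds \<open>e\<close>.\<close>
            then obtain l where l: "k = Suc l" "s \<le> l" by (cases k) auto
            have "e < ?as ! k"
              using cs_ge[of l] cs_high[of l] l rows[OF k(1)] len_cs s(1) by simp
            then show "k < length ?as \<and> ?as ! k \<in> {Suc e..<u}"
              using rows[OF k(1)] k(2) by simp
          qed auto
          then show ?thesis using fin by simp
        qed
        show ?thesis
          using tab' bal' cuts_le_move[OF fin disj xA e xe before after] e xB xA disj xe
          by (intro exI[of _ "insert e (A - {x})"] exI[of _ "B - {e}"]) auto
      qed
    qed
  qed
qed

lemma fold_remove_entry:
  assumes "ballot A B" "distinct xs" "set xs \<subseteq> A \<union> B" "set xs \<inter> {i..<j} = {}"
  shows "\<exists>A' B'. fold remove_entry xs (tab A B) = tab A' B' \<and> ballot A' B' \<and>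
    A' \<union> B' = A \<union> B - set xs \<and> cuts_le A B A' B' i j \<and> cuts_le A' B' A B i j"
  using assms
proof (induction xs arbitrary: A B)
  case Nil
  then show ?case using cuts_le_refl by (intro exI[of _ A] exI[of _ B]) auto
next
  case (Cons x xs)
  obtain A1 B1 where 1: "remove_entry x (tab A B) = tab A1 B1" "ballot A1 B1"
    "A1 \<union> B1 = A \<union> B - {x}" "cuts_le A B A1 B1 i j" "cuts_le A1 B1 A B i j"
    using remove_entry_tab[OF Cons.prems(1), of x] Cons.prems(3,4) by auto
  have "set xs \<subseteq> A1 \<union> B1" using 1(3) Cons.prems(2,3) by auto
  then obtain A' B' where 2: "fold remove_entry xs (tab A1 B1) = tab A' B'" "ballot A' B'"
    "A' \<union> B' = A1 \<union> B1 - set xs" "cuts_le A1 B1 A' B' i j" "cuts_le A' B' A1 B1 i j"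
    using Cons.IH[OF 1(2)] Cons.prems by auto
  have "A' \<union> B' = A \<union> B - set (x # xs)" using 1(3) 2(3) by auto
  then show ?case
    using 1(1) 2(1,2) cuts_le_trans[OF 1(4) 2(4)] cuts_le_trans[OF 2(5) 1(5)]
    by (intro exI[of _ A'] exI[of _ B']) simp
qed

text \<open>A standard tableau has \<open>m\<^sub>k = k\<close>, so exactly the letters outside the
  closed interval from \<open>i\<close> to \<open>j\<close> are removed; as a half-open window it
  ends at \<open>Suc j\<close>.\<close>

lemma projection_tab:
  assumes "ballot A B" "A \<union> B = {1..n}" "1 \<le> i" "i < j" "j \<le> n"
  shows "\<exists>A' B'. projection i j (tab A B) = tab A' B' \<and> ballot A' B' \<and>
    A' \<union> B' = {i..<Suc j} \<and> cuts_le A B A' B' i (Suc j) \<and> cuts_le A' B' A B i (Suc j)"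
proof -
  let ?xs = "[1..<i] @ [Suc j..<Suc n]"
  have "entries (tab A B) = {1..<Suc n}"
    using assms(1,2) by (auto simp: entries_tab ballot_def)
  then have "sorted_list_of_set (entries (tab A B)) = [1..<Suc n]"
    by (simp only: sorted_list_of_set_range)
  moreover have "take (i - 1) [1..<Suc n] = [1..<i]"
    using assms(3-5) by (subst take_upt) auto
  moreover have "drop j [1..<Suc n] = [Suc j..<Suc n]"
    by (simp add: drop_upt del: upt_Suc)
  ultimately have "projection i j (tab A B) = fold remove_entry ?xs (tab A B)"
    by (simp add: projection_def Let_def del: upt_Suc)
  moreover have "A \<union> B - set ?xs = {i..<Suc j}"
    unfolding assms(2) set_append set_upt using assms(3-5) by auto
  moreover have "set ?xs \<subseteq> A \<union> B" "set ?xs \<inter> {i..<Suc j} = {}"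
    unfolding assms(2) set_append set_upt using assms(3-5) by auto
  moreover have "distinct ?xs" using assms(4) by (simp del: upt_Suc)
  ultimately show ?thesis using fold_remove_entry[OF assms(1), of ?xs i "Suc j"] by (simp del: upt_Suc)
qed

section \<open>The chain order as a comparison of cut sizes\<close>

lemma cut_size_le_card:
  assumes "ballot A B" "A \<union> B = {i..<j}" "t \<in> {i..j}"
  shows "cut_size A B i j t \<le> card A"
proof -
  have fin: "finite A" using assms(1) by (simp add: ballot_def)
  \<comment> \<open>With no entry outside the window, the ballot condition below \<open>t\<close>
    allows the cut to move to \<open>i\<close>, where it counts the whole first column.\<close>
  have "card (B \<inter> {i..<t}) \<le> card (A \<inter> {i..<t})"
  proof (cases t)
    case (Suc u)
    then have "B \<inter> {i..<t} = B \<inter> {..u}" "A \<inter> {i..<t} = A \<inter> {..u}" using assms(2) by auto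
    then show ?thesis using assms(1) by (simp add: ballot_def)
  qed simp
  moreover have "A \<inter> {i..<j} = A" using assms(2) by auto
  ultimately show ?thesis
    using card_Int_split[OF fin, of i t j] assms(3) by (simp add: cut_size_def)
qed

lemma cuts_le_iff_card:
  assumes "ballot A B" "A \<union> B = {i..<j}" "ballot A' B'" "A' \<union> B' = {i..<j}" "i \<le> j"
  shows "cuts_le A B A' B' i j \<longleftrightarrow> card A \<le> card A'"
proof -
  have full: "A \<inter> {i..<j} = A" "A' \<inter> {i..<j} = A'" using assms(2,4) by auto
  have top: "cut_size A B i j i = card A" "cut_size A' B' i j i = card A'"
    by (simp_all add: cut_size_def full)
  show ?thesis
  proof
    assume "cuts_le A B A' B' i j"
    then obtain t where "t \<in> {i..j}" "card A \<le> cut_size A' B' i j t"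
      using top(1) assms(5) unfolding cuts_le_def by (metis atLeastAtMost_iff order_refl)
    then show "card A \<le> card A'" using cut_size_le_card[OF assms(3,4)] by fastforce
  next
    assume "card A \<le> card A'"
    then show "cuts_le A B A' B' i j"
      using cut_size_le_card[OF assms(1,2)] top(2) assms(5) unfolding cuts_le_def
      by (metis atLeastAtMost_iff order_refl order_trans)
  qed
qed

lemma shape_tab:
  assumes "ballot A B" "A \<union> B \<noteq> {}"
  shows "shape (tab A B) = card A # (if B = {} then [] else [card B])"
proof -
  have "A \<noteq> {}" "finite A" "finite B"
    using assms ballot_empty[of B] by (auto simp: ballot_def)
  then show ?thesis by (auto simp: tab_simps shape_def)
qed

text \<open>Both shapes have the same number of boxes, so the partial sums of two columns agree and
  only the first column length decides.\<close>

lemma dominance_le_tab: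
  assumes "ballot A B" "ballot A' B'" "A \<union> B = A' \<union> B'" "A \<union> B \<noteq> {}"
  shows "dominance_le (shape (tab A B)) (shape (tab A' B')) \<longleftrightarrow> card A \<le> card A'"
proof -
  have "card (A \<union> B) = card A + card B" "card (A' \<union> B') = card A' + card B'"
    using assms(1,2) by (auto simp: ballot_def card_Un_disjoint)
  then have eq: "card A + card B = card A' + card B'" using assms(3) by simp
  have "A' \<union> B' \<noteq> {}" using assms by simp
  note sh = shape_tab[OF assms(1,4)] shape_tab[OF assms(2) this]
  show ?thesis
  proof
    assume "dominance_le (shape (tab A B)) (shape (tab A' B'))"
    then have "sum_list (take 1 (shape (tab A B))) \<le> sum_list (take 1 (shape (tab A' B')))"
      unfolding dominance_le_def sh by (elim allE[of _ 1] impE) simp_all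
    then show "card A \<le> card A'" unfolding sh by simp
  next
    assume le: "card A \<le> card A'"
    show "dominance_le (shape (tab A B)) (shape (tab A' B'))"
      unfolding dominance_le_def
    proof (intro allI impI)
      fix k assume "k \<le> length (shape (tab A B)) \<and> k \<le> length (shape (tab A' B'))"
      then consider "k = 0" | "k = 1" | "k = 2" "B \<noteq> {}" "B' \<noteq> {}"
        unfolding sh by (auto simp: le_Suc_eq numeral_2_eq_2 split: if_splits)
      then show "sum_list (take k (shape (tab A B))) \<le> sum_list (take k (shape (tab A' B')))"
        unfolding sh using le eq by cases auto
    qed
  qed
qed

lemma chain_le_iff_cuts_le:
  assumes "ballot A B" "A \<union> B = {1..n}" "ballot A' B'" "A' \<union> B' = {1..n}"
  shows "chain_le n (tab A B) (tab A' B') \<longleftrightarrow>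
    (\<forall>i j. 1 \<le> i \<and> i < j \<and> j \<le> n \<longrightarrow> cuts_le A B A' B' i (Suc j))"
proof -
  have "dominance_le (shape (projection i j (tab A B))) (shape (projection i j (tab A' B')))
      \<longleftrightarrow> cuts_le A B A' B' i (Suc j)"
    if ij: "1 \<le> i \<and> i < j \<and> j \<le> n" for i j
  proof -
    obtain C D where C: "projection i j (tab A B) = tab C D" "ballot C D"
      "C \<union> D = {i..<Suc j}" "cuts_le A B C D i (Suc j)" "cuts_le C D A B i (Suc j)"
      using projection_tab[OF assms(1,2)] ij by metis
    obtain C' D' where C': "projection i j (tab A' B') = tab C' D'" "ballot C' D'"
      "C' \<union> D' = {i..<Suc j}" "cuts_le A' B' C' D' i (Suc j)" "cuts_le C' D' A' B' i (Suc j)"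
      using projection_tab[OF assms(3,4)] ij by metis
    have "dominance_le (shape (tab C D)) (shape (tab C' D')) \<longleftrightarrow> cuts_le C D C' D' i (Suc j)"
      using dominance_le_tab[OF C(2) C'(2)] cuts_le_iff_card[OF C(2,3) C'(2,3)] C(3) C'(3) ij
      by simp
    also have "\<dots> \<longleftrightarrow> cuts_le A B A' B' i (Suc j)"
      using C(4,5) C'(4,5) cuts_le_trans by meson
    finally show ?thesis using C(1) C'(1) by simp
  qed
  then show ?thesis unfolding chain_le_def by blast
qed

subsection \<open>Column insertion with at most two columns\<close>

text \<open>This recursion replaces comparisons of \<open>position\<close>. It follows the insertion
  process, in which a letter put in front of the word is inserted last.\<close>

fun precedes :: "'a list \<Rightarrow> 'a \<Rightarrow> 'a \<Rightarrow> bool" where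
  "precedes [] p q \<longleftrightarrow> False"
| "precedes (x # w) p q \<longleftrightarrow> p = x \<and> q \<in> set w \<or> precedes w p q"

lemma precedes_in_set: "precedes w p q \<Longrightarrow> p \<in> set w \<and> q \<in> set w"
  by (induction w) auto

lemma precedes_append:
  "precedes (v @ w) p q \<longleftrightarrow> precedes v p q \<or> p \<in> set v \<and> q \<in> set w \<or> precedes w p q"
  by (induction v) auto

lemma precedes_iff_position:
  assumes "distinct w" "p \<in> set w" "q \<in> set w"
  shows "precedes w p q \<longleftrightarrow> position w p < position w q"
proof -
  have pos: "position w (w ! k) = k" if "k < length w" for k
    using assms(1) that unfolding position_def
    by (intro the_equality) (auto simp: nth_eq_iff_index_eq)
  have "precedes w (w ! k) (w ! l) \<longleftrightarrow> k < l" if "k < length w" "l < length w" for k l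
    using assms(1) that
  proof (induction w arbitrary: k l)
    case (Cons x w)
    then show ?case
      by (cases k; cases l) (auto dest: precedes_in_set)
  qed simp
  then show ?thesis using pos assms(2,3) by (metis in_set_conv_nth)
qed

lemma precedes_linear:
  assumes "distinct w" "p \<in> set w" "q \<in> set w" "p \<noteq> q"
  shows "precedes w p q \<longleftrightarrow> \<not> precedes w q p"
  using assms
proof (induction w)
  case (Cons x w)
  then show ?case by (auto dest: precedes_in_set)
qed simp

lemma append_column:
  fixes A :: "nat set"
  assumes "finite A" "\<forall>a\<in>A. a < x"
  shows "sorted_list_of_set A @ [x] = sorted_list_of_set (insert x A)"
  using assms by (intro sorted_list_of_set_unique[symmetric]) (auto simp: sorted_wrt_append)

lemma bump_column:
  fixes A :: "nat set"
  assumes "finite A" "x \<notin> A" "c \<in> A" "x < c" "\<forall>a\<in>A. a < c \<longrightarrow> a < x"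
  shows "Min {y \<in> A. x < y} = c"
    and "map (\<lambda>y. if y = c then x else y) (sorted_list_of_set A) =
      sorted_list_of_set (insert x (A - {c}))"
proof -
  show "Min {y \<in> A. x < y} = c" using assms by (intro Min_eqI) (auto simp: not_less[symmetric])
  let ?f = "\<lambda>y. if y = c then x else y"
  have "sorted_wrt (<) (map ?f (sorted_list_of_set A))"
    unfolding sorted_wrt_map
    by (rule sorted_wrt_mono_rel[of _ "(<)"]) (use assms in auto)
  then show "map ?f (sorted_list_of_set A) = sorted_list_of_set (insert x (A - {c}))"
    using assms by (intro sorted_list_of_set_unique[symmetric]) auto
qed

text \<open>Insertion never loses a column, so a third column persists once it has appeared.\<close>

lemma column_insert_length: "length T \<le> length (column_insert x T)"
  by (induction x T rule: column_insert.induct) (auto simp: Let_def)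

lemma tab_Cons:
  assumes "A \<noteq> {}" "finite A" "finite B"
  shows "tab A B = sorted_list_of_set A # (if B = {} then [] else [sorted_list_of_set B])"
  using assms by (simp add: tab_simps)

lemma column_insert_append:
  assumes "finite A" "finite B" "A = {} \<longrightarrow> B = {}" "\<forall>a\<in>A. a < x"
  shows "column_insert x (tab A B) = tab (insert x A) B"
proof (cases "A = {}")
  case True
  then show ?thesis using assms(3) by (simp add: tab_def)
next
  case False
  have "column_insert x (sorted_list_of_set A # Cs) = sorted_list_of_set (insert x A) # Cs" for Cs
    using append_column[OF assms(1,4)] assms(1,4) by (auto simp: not_less less_imp_le)
  then show ?thesis
    using tab_Cons[OF False assms(1,2)] tab_Cons[of "insert x A" B] assms(1,2)
    by (simp only: finite_insert insert_not_empty simp_thms)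
qed

lemma column_insert_bump:
  assumes "finite A" "finite B" "x \<notin> A" "c \<in> A" "x < c" "\<forall>a\<in>A. a < c \<longrightarrow> a < x"
  shows "(\<forall>b\<in>B. b < c) \<Longrightarrow> column_insert x (tab A B) = tab (insert x (A - {c})) (insert c B)"
    and "d \<in> B \<Longrightarrow> c < d \<Longrightarrow> length (column_insert x (tab A B)) = 3"
proof -
  have A: "A \<noteq> {}" "\<exists>y\<in>A. x < y" using assms by auto
  have one: "column_insert x (sorted_list_of_set A # Cs) =
      sorted_list_of_set (insert x (A - {c})) # column_insert c Cs" for Cs
    using assms(1) A(2) bump_column[OF assms(1,3-6)] by (simp add: Let_def)
  show "column_insert x (tab A B) = tab (insert x (A - {c})) (insert c B)" if "\<forall>b\<in>B. b < c"
  proof -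
    have "column_insert c (if B = {} then [] else [sorted_list_of_set B]) =
        [sorted_list_of_set (insert c B)]"
      using append_column[OF assms(2) that] assms(2) that by (auto simp: not_less less_imp_le)
    then have "column_insert x (tab A B) =
        [sorted_list_of_set (insert x (A - {c})), sorted_list_of_set (insert c B)]"
      by (simp only: one tab_Cons[OF A(1) assms(1,2)])
    then show ?thesis
      using tab_Cons[of "insert x (A - {c})" "insert c B"] assms(1,2)
      by (simp only: finite_insert insert_not_empty finite_Diff if_False simp_thms)
  qed
  show "length (column_insert x (tab A B)) = 3" if "d \<in> B" "c < d"
  proof -
    have "tab A B = [sorted_list_of_set A, sorted_list_of_set B]"
      using A(1) assms(1,2) that by (intro tab_simps) auto
    moreover have "length (column_insert c [sorted_list_of_set B]) = 2"
      using that assms(2) by (auto simp: Let_def)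
    ultimately show ?thesis by (simp only: one list.size)
  qed
qed

text \<open>Insertion that never reaches a third column; \<open>c\<close> is the bumped letter.\<close>

inductive two_col :: "nat list \<Rightarrow> nat set \<Rightarrow> nat set \<Rightarrow> bool" where
  Nil: "two_col [] {} {}"
| append: "two_col w A B \<Longrightarrow> x \<notin> set w \<Longrightarrow> \<forall>a\<in>A. a < x \<Longrightarrow> two_col (x # w) (insert x A) B"
| bump: "two_col w A B \<Longrightarrow> x \<notin> set w \<Longrightarrow> c \<in> A \<Longrightarrow> x < c \<Longrightarrow> \<forall>a\<in>A. a < c \<longrightarrow> a < x \<Longrightarrow>
    \<forall>b\<in>B. b < c \<Longrightarrow> two_col (x # w) (insert x (A - {c})) (insert c B)"

lemma two_col_sets:
  assumes "two_col w A B"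
  shows "finite A" "finite B" "A \<inter> B = {}" "A = {} \<longrightarrow> B = {}" "A \<union> B = set w" "distinct w"
  using assms by (induction rule: two_col.induct) auto

lemma two_col_tableau: "two_col w A B \<Longrightarrow> tableau_of_word w = tab A B"
proof (induction rule: two_col.induct)
  case Nil
  then show ?case by (simp add: tableau_of_word_def tab_def)
next
  case (append w A B x)
  then show ?case
    using column_insert_append[of A B x] two_col_sets[OF append.hyps(1)]
    by (simp add: tableau_of_word_def)
next
  case (bump w A B x c)
  then show ?case
    using column_insert_bump(1)[of A B x c] two_col_sets[OF bump.hyps(1)]
    by (auto simp: tableau_of_word_def)
qed

text \<open>Supplies the last two letters of an increasing triple when an insertion would open a
  third column. If \<open>b\<close> is the letter just bumped, the inserted letter serves as
  \<open>e\<close>, because \<open>A\<close> has nothing between them; older ascents survive in the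
  longer word.\<close>

lemma two_col_separated:
  assumes "two_col w A B" "b \<in> B" "a \<in> A" "a < b"
  shows "\<exists>e. a \<le> e \<and> e < b \<and> precedes w e b"
  using assms
proof (induction arbitrary: a b rule: two_col.induct)
  case (append w A B x)
  have "b \<in> set w" using two_col_sets(5)[OF append.hyps(1)] append.prems by auto
  show ?case
  proof (cases "a = x")
    case True
    then show ?thesis using append.prems \<open>b \<in> set w\<close> by (intro exI[of _ x]) auto
  next
    case False
    then show ?thesis using append.IH[of b a] append.prems by auto
  qed
next
  case (bump w A B x c)
  have sets: "c \<in> set w" "B \<subseteq> set w" using two_col_sets(5)[OF bump.hyps(1)] bump.hyps by auto
  show ?case
  proof (cases "b = c")
    case True
    then have "a \<le> x" using bump.prems bump.hyps by auto
    then show ?thesis using True bump.hyps(4) sets by (intro exI[of _ x]) auto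
  next
    case False
    then have b: "b \<in> B" using bump.prems by simp
    show ?thesis
    proof (cases "a = x")
      case True
      then show ?thesis using bump.prems sets b by (intro exI[of _ x]) auto
    next
      case False
      then show ?thesis using bump.IH[OF b, of a] bump.prems by auto
    qed
  qed
qed simp

text \<open>An ascent of the word leaves a trace in the tableau: some \<open>a \<ge> y\<close> in
  the first column is smaller than some entry of the second. A letter below \<open>y\<close> put in
  front could then neither be appended nor bump without opening a third column.\<close>

lemma two_col_ascent:
  assumes "two_col w A B" "precedes w y z" "y < z"
  shows "\<exists>a\<in>A. \<exists>b\<in>B. y \<le> a \<and> a < b"
  using assms
proof (induction arbitrary: y z rule: two_col.induct)
  case (append w A B x)
  show ?case
  proof (cases "precedes w y z")
    case True
    then show ?thesis using append by blast
  next
    case False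
    then have "y = x" "z \<in> A \<union> B"
      using append.prems two_col_sets(5)[OF append.hyps(1)] by auto
    then show ?thesis using append.hyps(3) append.prems by auto
  qed
next
  case (bump w A B x c)
  show ?case
  proof (cases "precedes w y z")
    case True
    then obtain a b where "a \<in> A" "b \<in> B" "y \<le> a" "a < b" using bump by blast
    moreover from this have "a \<noteq> c" using bump.hyps(6) by force
    ultimately show ?thesis by blast
  next
    case False
    then show ?thesis using bump.prems bump.hyps(4) by auto
  qed
qed simp

section \<open>Increasing subsequences of length three and the third column\<close>

definition increasing_triple :: "nat list \<Rightarrow> bool" where
  "increasing_triple w \<longleftrightarrow> (\<exists>p q r. p < q \<and> q < r \<and> precedes w p q \<and> precedes w q r)"

lemma two_col_no_triple: "two_col w A B \<Longrightarrow> \<not> increasing_triple w"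
proof (induction rule: two_col.induct)
  case Nil
  then show ?case by (simp add: increasing_triple_def)
next
  case (append w A B x)
  have "False" if *: "p < q" "q < r" "precedes (x # w) p q" "precedes (x # w) q r" for p q r
  proof -
    have qr: "precedes w q r" "q \<in> set w" using * append.hyps(2) by (auto dest: precedes_in_set)
    then obtain a b where "a \<in> A" "q \<le> a" "a < b"
      using two_col_ascent[OF append.hyps(1)] * by blast
    \<comment> \<open>Otherwise \<open>x < q \<le> a\<close>, although \<open>x\<close> was appended
      below all of \<open>A\<close>.\<close>
    then have "p \<noteq> x" using append.hyps(3) * by force
    then show False using append.IH * qr unfolding increasing_triple_def by auto
  qed
  then show ?case unfolding increasing_triple_def by blast
next
  case (bump w A B x c)
  have "False" if *: "p < q" "q < r" "precedes (x # w) p q" "precedes (x # w) q r" for p q r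
  proof -
    have qr: "precedes w q r" "q \<in> set w" using * bump.hyps(2) by (auto dest: precedes_in_set)
    then obtain a b where "a \<in> A" "b \<in> B" "q \<le> a" "a < b"
      using two_col_ascent[OF bump.hyps(1)] * by blast
    \<comment> \<open>Otherwise \<open>x < a\<close>, hence \<open>c \<le> a < b\<close> by the
      choice of \<open>c\<close>, although all of \<open>B\<close> lies below
      \<open>c\<close>.\<close>
    then have "p \<noteq> x" using bump.hyps(5,6) * by force
    then show False using bump.IH * qr unfolding increasing_triple_def by auto
  qed
  then show ?case unfolding increasing_triple_def by blast
qed

text \<open>Schensted's criterion for increasing subsequences of length three. Both alternatives are
  carried through the induction because a third column has to come with a triple as the word grows
  to the left.\<close>

lemma two_col_cases:
  assumes "distinct w"
  obtains A B where "two_col w A B" "\<not> increasing_triple w"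
  | "increasing_triple w" "length (tableau_of_word w) \<ge> 3"
  using assms
proof (induction w arbitrary: thesis)
  case Nil
  then show ?case using two_col.Nil two_col_no_triple by blast
next
  case (Cons x w)
  have word: "tableau_of_word (x # w) = column_insert x (tableau_of_word w)"
    by (simp add: tableau_of_word_def)
  show ?case
  proof (rule Cons.IH)
    show "distinct w" using Cons.prems by simp
  next
    assume "increasing_triple w" "length (tableau_of_word w) \<ge> 3"
    moreover from this(1) have "increasing_triple (x # w)"
      by (auto simp: increasing_triple_def)
    ultimately show thesis
      using word column_insert_length Cons.prems(2) by (metis order_trans)
  next
    fix A B assume w: "two_col w A B"
    note sets = two_col_sets[OF w]
    have x: "x \<notin> set w" using Cons.prems by simp
    then have xA: "x \<notin> A" using sets(5) by auto
    show thesis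
    proof (cases "\<forall>a\<in>A. a < x")
      case True
      then show ?thesis using two_col.append[OF w x] two_col_no_triple Cons.prems(1) by blast
    next
      case False
      define c where "c = Min {a \<in> A. x < a}"
      have ne: "{a \<in> A. x < a} \<noteq> {}" "finite {a \<in> A. x < a}"
        using False xA sets(1) by (auto simp: not_less le_less)
      have c: "c \<in> A" "x < c" using Min_in[OF ne(2,1)] by (auto simp: c_def)
      have c_min: "\<forall>a\<in>A. a < c \<longrightarrow> a < x"
        using Min_le[OF ne(2)] xA unfolding c_def[symmetric]
        by (metis (mono_tags, lifting) linorder_neqE_nat mem_Collect_eq not_le)
      show ?thesis
      proof (cases "\<forall>b\<in>B. b < c")
        case True
        then show ?thesis
          using two_col.bump[OF w x c c_min] two_col_no_triple Cons.prems(1) by blast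
      next
        case False
        then obtain d where d: "d \<in> B" "c < d"
          using c(1) sets(3) by (metis disjoint_iff linorder_neqE_nat)
        \<comment> \<open>The inserted \<open>x\<close> bumps \<open>c\<close>, which would bump
          again because of \<open>d\<close>; then \<open>x < c \<le> e < d\<close> makes
          \<open>x\<close>, \<open>e\<close>, \<open>d\<close> an increasing triple.\<close>
        obtain e where e: "c \<le> e" "e < d" "precedes w e d"
          using two_col_separated[OF w d(1) c(1) d(2)] by blast
        then have "increasing_triple (x # w)"
          using c(2) precedes_in_set[OF e(3)] unfolding increasing_triple_def
          by (intro exI[of _ x] exI[of _ e] exI[of _ d]) auto
        moreover have "length (tableau_of_word (x # w)) = 3"
          using column_insert_bump(2)[OF sets(1,2) xA c c_min d] word two_col_tableau[OF w] by simp
        ultimately show ?thesis using Cons.prems(2) by simp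
      qed
    qed
  qed
qed

subsection \<open>Decreasing subsequences\<close>

definition decreasing_set :: "nat list \<Rightarrow> nat set \<Rightarrow> bool" where
  "decreasing_set w D \<longleftrightarrow> D \<subseteq> set w \<and> (\<forall>p\<in>D. \<forall>q\<in>D. p < q \<longrightarrow> precedes w q p)"

lemma decreasing_set_Cons:
  assumes "decreasing_set w D" "D \<subseteq> {..<x}"
  shows "decreasing_set (x # w) (insert x D)"
  using assms unfolding decreasing_set_def by fastforce

lemma decreasing_set_ConsD:
  assumes "decreasing_set (x # w) D" "x \<notin> set w"
  shows "decreasing_set w (D - {x})" and "x \<in> D \<Longrightarrow> D - {x} \<subseteq> {..<x}"
proof -
  show "decreasing_set w (D - {x})" using assms(1) unfolding decreasing_set_def by auto
  show "D - {x} \<subseteq> {..<x}" if "x \<in> D"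
  proof
    fix q assume q: "q \<in> D - {x}"
    have "\<not> x < q"
    proof
      assume "x < q"
      then have "precedes (x # w) q x" using assms(1) q that unfolding decreasing_set_def by auto
      then show False using q assms(2) by (auto dest: precedes_in_set)
    qed
    then show "q \<in> {..<x}" using q by auto
  qed
qed

text \<open>For decreasing sets that contain the newly inserted \<open>x\<close>: as
  \<open>x\<close> comes first in the word, the other members are smaller, so the window may be
  shortened to end at \<open>x\<close>, and \<open>x\<close> itself adds one to the first-column
  part.\<close>

lemma cut_size_insert_less:
  assumes "finite A'" "finite B'" "x \<notin> A" "A \<inter> {..<x} \<subseteq> A'" "x \<in> A'" "B \<subseteq> B'" "t \<le> x" "x < j"
  shows "cut_size A B i x t + 1 \<le> cut_size A' B' i j t"
proof -
  have "card (insert x (A \<inter> {t..<x})) \<le> card (A' \<inter> {t..<j})"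
    using assms by (intro card_mono) auto
  moreover have "card (B \<inter> {i..<t}) \<le> card (B' \<inter> {i..<t})"
    using assms by (intro card_mono) auto
  ultimately show ?thesis by (simp add: cut_size_def)
qed

lemma cut_size_append:
  assumes "finite A" "\<forall>a\<in>A. a < x"
  shows "cut_size (insert x A) B i j t = cut_size A B i j t + of_bool (x \<in> {t..<j})"
  using card_insert_Int[of A x "{t..<j}"] assms by (auto simp: cut_size_def)

lemma cut_size_bump:
  assumes "finite A" "finite B" "x \<notin> A" "c \<in> A" "\<forall>b\<in>B. b < c"
  shows "cut_size (insert x (A - {c})) (insert c B) i j t + of_bool (c \<in> {t..<j}) =
    cut_size A B i j t + of_bool (x \<in> {t..<j}) + of_bool (c \<in> {i..<t})"
  using card_insert_Int[of "A - {c}" x "{t..<j}"] card_Diff_Int[of A c "{t..<j}"]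
    card_insert_Int[of B c "{i..<t}"] assms by (auto simp: cut_size_def)

lemma cut_size_cong:
  assumes "A \<inter> {t..<j} = A' \<inter> {t..<j'}"
  shows "cut_size A B i j t = cut_size A' B i j' t"
  using assms by (simp add: cut_size_def)

text \<open>Schensted's theorem for two columns, localized to the letters of an interval.\<close>

lemma decreasing_set_le_cut_size:
  assumes "two_col w A B" "decreasing_set w D" "D \<subseteq> {i..<j}" "i \<le> j"
  shows "\<exists>t\<in>{i..j}. card D \<le> cut_size A B i j t"
  using assms
proof (induction arbitrary: D j rule: two_col.induct)
  case Nil
  then show ?case by (intro bexI[of _ i]) (auto simp: decreasing_set_def)
next
  case (append w A B x)
  note sets = two_col_sets[OF append.hyps(1)]
  have xA: "x \<notin> A" using append.hyps(3) by auto
  show ?case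
  proof (cases "x \<in> D")
    case True
    note D = decreasing_set_ConsD[OF append.prems(1) append.hyps(2)]
    have "D - {x} \<subseteq> {..<x} \<inter> {i..<j}" using D(2)[OF True] append.prems(2) by blast
    also have "\<dots> \<subseteq> {i..<x}" by auto
    finally have "D - {x} \<subseteq> {i..<x}" .
    moreover have "i \<le> x" "x < j" "finite D"
      using append.prems(2) True by (auto intro: finite_subset)
    ultimately obtain t where t: "t \<in> {i..x}" "card (D - {x}) \<le> cut_size A B i x t"
      using append.IH[OF D(1)] by blast
    have "cut_size A B i x t + 1 \<le> cut_size (insert x A) B i j t"
      using t \<open>x < j\<close> xA sets by (intro cut_size_insert_less) auto
    moreover have "card D = card (D - {x}) + 1" using card_Suc_Diff1[OF \<open>finite D\<close> True] by simp
    ultimately show ?thesis using t \<open>x < j\<close> by (intro bexI[of _ t]) auto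
  next
    case False
    then obtain t where "t \<in> {i..j}" "card D \<le> cut_size A B i j t"
      using append.IH[of D j] decreasing_set_ConsD(1)[OF append.prems(1) append.hyps(2)]
        append.prems by auto
    then show ?thesis using cut_size_append[OF sets(1) append.hyps(3)]
      by (intro bexI[of _ t]) auto
  qed
next
  case (bump w A B x c)
  note sets = two_col_sets[OF bump.hyps(1)]
  have xA: "x \<notin> A" using bump.hyps(2) sets(5) by auto
  let ?A = "insert x (A - {c})" and ?B = "insert c B"
  note move = cut_size_bump[OF sets(1,2) xA bump.hyps(3,6)]
  show ?case
  proof (cases "x \<in> D")
    case True
    note D = decreasing_set_ConsD[OF bump.prems(1) bump.hyps(2)]
    have "D - {x} \<subseteq> {..<x} \<inter> {i..<j}" using D(2)[OF True] bump.prems(2) by blast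
    also have "\<dots> \<subseteq> {i..<x}" by auto
    finally have "D - {x} \<subseteq> {i..<x}" .
    moreover have "i \<le> x" "x < j" "finite D"
      using bump.prems(2) True by (auto intro: finite_subset)
    ultimately obtain t where t: "t \<in> {i..x}" "card (D - {x}) \<le> cut_size A B i x t"
      using bump.IH[OF D(1)] by blast
    have "cut_size A B i x t + 1 \<le> cut_size ?A ?B i j t"
      using t \<open>x < j\<close> xA sets bump.hyps(4) by (intro cut_size_insert_less) auto
    moreover have "card D = card (D - {x}) + 1" using card_Suc_Diff1[OF \<open>finite D\<close> True] by simp
    ultimately show ?thesis using t \<open>x < j\<close> by (intro bexI[of _ t]) auto
  next
    case False
    then obtain t where t: "t \<in> {i..j}" "card D \<le> cut_size A B i j t"
      using bump.IH[of D j] decreasing_set_ConsD(1)[OF bump.prems(1) bump.hyps(2)]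
        bump.prems by auto
    show ?thesis
    \<comment> \<open>Only in this case does the cut lose the bumped \<open>c\<close> without
      gaining \<open>x\<close>. Since \<open>A\<close> has nothing in \<open>{t..<c}\<close>, moving
      the cut to \<open>Suc c\<close> costs at most one, and there \<open>c\<close> is counted
      again, in the second column.\<close>
    proof (cases "x < t \<and> t \<le> c \<and> c < j")
      case True
      have "A \<inter> {t..<j} = A \<inter> {c..<j}" using bump.hyps(5) True by auto
      moreover have "A \<inter> {c..<j} = insert c (A \<inter> {Suc c..<j})" using True bump.hyps(3) by auto
      moreover have "card (B \<inter> {i..<t}) \<le> card (B \<inter> {i..<Suc c})"
        using True sets by (intro card_mono) auto
      ultimately have "cut_size A B i j t \<le> cut_size A B i j (Suc c) + 1"
        using sets(1) by (simp add: cut_size_def)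
      also have "\<dots> = cut_size ?A ?B i j (Suc c)"
        using move[of i j "Suc c"] True t(1) bump.hyps(4) by simp
      finally show ?thesis using t True by (intro bexI[of _ "Suc c"]) auto
    next
      case False
      then have "cut_size A B i j t \<le> cut_size ?A ?B i j t"
        using move[of i j t] bump.hyps(4) by (cases "c < j"; cases "x < j") auto
      then show ?thesis using t by (intro bexI[of _ t]) auto
    qed
  qed
qed

text \<open>The reverse inequality: every cut is realized by a decreasing set. When \<open>x\<close>
  bumps \<open>c\<close> there are three cases. If \<open>c\<close> lies below the cut, the old cut
  at \<open>c\<close> is at least as large. If \<open>x\<close> is counted and \<open>c\<close> is
  beyond the window, a decreasing set below \<open>x\<close> is extended by \<open>x\<close>.
  Otherwise the cut does not grow.\<close>

lemma cut_size_le_decreasing_set: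
  assumes "two_col w A B" "t \<in> {i..j}"
  shows "\<exists>D. decreasing_set w D \<and> D \<subseteq> {i..<j} \<and> cut_size A B i j t \<le> card D"
  using assms
proof (induction arbitrary: t j rule: two_col.induct)
  case Nil
  then show ?case by (intro exI[of _ "{}"]) (auto simp: decreasing_set_def cut_size_def)
next
  case (append w A B x)
  note sets = two_col_sets[OF append.hyps(1)]
  have weaken: "decreasing_set w D \<Longrightarrow> decreasing_set (x # w) D" for D
    by (auto simp: decreasing_set_def)
  show ?case
  proof (cases "x \<in> {t..<j}")
    case True
    then have "t \<in> {i..x}" using append.prems by simp
    from append.IH[OF this] obtain D where
      D: "decreasing_set w D" "D \<subseteq> {i..<x}" "cut_size A B i x t \<le> card D" by blast
    have "cut_size A B i j t = cut_size A B i x t"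
      using append.hyps(3) True by (intro cut_size_cong) auto
    moreover have "card (insert x D) = card D + 1"
      using D(2) by (subst card_insert_disjoint) (auto intro: finite_subset)
    moreover have "decreasing_set (x # w) (insert x D)"
      using D by (intro decreasing_set_Cons) auto
    ultimately show ?thesis
      using D True append.prems cut_size_append[OF sets(1) append.hyps(3), of B i j t]
      by (intro exI[of _ "insert x D"]) auto
  next
    case False
    then show ?thesis
      using append.IH[OF append.prems] cut_size_append[OF sets(1) append.hyps(3), of B i j t] weaken
      by auto
  qed
next
  case (bump w A B x c)
  note sets = two_col_sets[OF bump.hyps(1)]
  have xA: "x \<notin> A" using bump.hyps(2) sets(5) by auto
  note move = cut_size_bump[OF sets(1,2) xA bump.hyps(3,6), of i j t]
  have weaken: "decreasing_set w D \<Longrightarrow> decreasing_set (x # w) D" for D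
    by (auto simp: decreasing_set_def)
  consider "c \<in> {i..<t}" | "c \<notin> {i..<t}" "x \<in> {t..<j}" "j \<le> c"
    | "c \<notin> {i..<t}" "x \<in> {t..<j} \<longrightarrow> c < j" by fastforce
  then show ?case
  proof cases
    case 1
    have "card (insert c (A \<inter> {t..<j})) \<le> card (A \<inter> {c..<j})"
      using 1 sets bump.hyps(3) bump.prems by (intro card_mono) auto
    moreover have "card (insert c (A \<inter> {t..<j})) = card (A \<inter> {t..<j}) + 1"
      using 1 sets by (subst card_insert_disjoint) auto
    moreover have "B \<inter> {i..<t} = B \<inter> {i..<c}" using 1 bump.hyps(6) by auto
    ultimately have "cut_size A B i j t + 1 \<le> cut_size A B i j c" by (simp add: cut_size_def)
    then have "cut_size (insert x (A - {c})) (insert c B) i j t \<le> cut_size A B i j c"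
      using move 1 bump.hyps(4) by simp
    moreover have "c \<in> {i..j}" using 1 bump.prems by auto
    ultimately show ?thesis using bump.IH[of c j] weaken order_trans by blast
  next
    case 2
    then have "t \<in> {i..x}" using bump.prems by simp
    from bump.IH[OF this] obtain D where
      D: "decreasing_set w D" "D \<subseteq> {i..<x}" "cut_size A B i x t \<le> card D" by blast
    have "cut_size A B i j t = cut_size A B i x t"
      using bump.hyps(5) 2 by (intro cut_size_cong) auto
    moreover have "card (insert x D) = card D + 1"
      using D(2) by (subst card_insert_disjoint) (auto intro: finite_subset)
    moreover have "decreasing_set (x # w) (insert x D)"
      using D by (intro decreasing_set_Cons) auto
    ultimately show ?thesis
      using D 2 bump.prems move by (intro exI[of _ "insert x D"]) auto
  next
    case 3
    then have "cut_size (insert x (A - {c})) (insert c B) i j t \<le> cut_size A B i j t"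
      using move bump.hyps(4) by (cases "x \<in> {t..<j}") auto
    then show ?thesis using bump.IH[OF bump.prems] weaken order_trans by blast
  qed
qed

section \<open>From the Duflo order to the chain order\<close>

lemma right_weak_le_iff:
  assumes "w \<in> permutations_of_set {1..n}" "y \<in> permutations_of_set {1..n}"
  shows "right_weak_le n w y \<longleftrightarrow> (\<forall>p q. p < q \<longrightarrow> precedes w q p \<longrightarrow> precedes y q p)"
proof -
  have w: "distinct w" "set w = {1..n}" and y: "distinct y" "set y = {1..n}"
    using assms by (auto simp: permutations_of_set_def)
  have "position w q < position w p \<longleftrightarrow> precedes w q p"
    "position y q < position y p \<longleftrightarrow> precedes y q p" if "1 \<le> p \<and> p < q \<and> q \<le> n" for p q
    using precedes_iff_position[OF w(1), of q p] precedes_iff_position[OF y(1), of q p] w(2) y(2)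
      that by auto
  moreover have "1 \<le> p \<and> q \<le> n" if "precedes w q p" for p q
    using precedes_in_set[OF that] w(2) by auto
  ultimately show ?thesis unfolding right_weak_le_def by meson
qed

definition duflo_step :: "nat \<Rightarrow> tableau \<Rightarrow> tableau \<Rightarrow> bool" where
  "duflo_step n T S \<longleftrightarrow> (\<exists>w\<in>word_class n T. \<exists>y\<in>word_class n S. right_weak_le n w y)"

lemma two_col_of_tab:
  assumes "w \<in> word_class n (tab A B)" "ballot A B"
  shows "two_col w A B"
proof -
  have w: "distinct w" "tableau_of_word w = tab A B"
    using assms(1) by (auto simp: word_class_def permutations_of_set_def)
  show ?thesis
  proof (rule two_col_cases[OF w(1)])
    fix A' B' assume "two_col w A' B'"
    moreover from this have "A' = A \<and> B' = B"
      using w(2) two_col_sets(1,2,4)[of w A' B'] two_col_tableau[of w A' B'] assms(2)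
        ballot_empty[of B]
      by (intro tab_inj) (auto simp: ballot_def)
    ultimately show ?thesis by simp
  qed (use w(2) length_tab[of A B] in auto)
qed

text \<open>Going up in the weak order only adds inversions. So ascents of \<open>y\<close> are
  ascents of \<open>w\<close>, which excludes increasing triples and keeps \<open>S\<close> at two
  columns, even though \<open>duflo_le\<close> admits arbitrary intermediate tableaux. Decreasing
  sets of \<open>w\<close> stay decreasing in \<open>y\<close>, which gives the inequality of cut
  sizes.\<close>

lemma duflo_step_cuts_le:
  assumes "duflo_step n (tab A B) S" "ballot A B" "S \<in> standard_tableaux n"
  obtains A' B' where "S = tab A' B'" "ballot A' B'" "A' \<union> B' = {1..n}"
    "\<And>i j. cuts_le A B A' B' i j"
proof -
  obtain w y where w: "w \<in> word_class n (tab A B)" and y: "y \<in> word_class n S"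
    and "right_weak_le n w y" using assms(1) by (auto simp: duflo_step_def)
  then have inv: "precedes y q p" if "p < q" "precedes w q p" for p q
    using right_weak_le_iff that by (auto simp: word_class_def)
  have perm: "distinct w" "distinct y" "set w = {1..n}" "set y = {1..n}"
    using w y by (auto simp: word_class_def permutations_of_set_def)
  have two_w: "two_col w A B" by (rule two_col_of_tab[OF w assms(2)])
  have asc: "precedes w p q" if "p < q" "precedes y p q" for p q
    using that inv[of p q] precedes_in_set[OF that(2)] perm precedes_linear
    by (metis less_irrefl)
  have "\<not> increasing_triple y"
    using two_col_no_triple[OF two_w] asc unfolding increasing_triple_def by blast
  then obtain C D where "two_col y C D" using two_col_cases[OF perm(2)] by blast
  then have "length S \<le> 2"
    using two_col_tableau length_tab y by (auto simp: word_class_def)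
  then obtain A' B' where S: "S = tab A' B'" "ballot A' B'" "entries S = A' \<union> B'"
    using assms(3) young_tableau_two_columns by (auto simp: standard_tableaux_def)
  have two_y: "two_col y A' B'" using two_col_of_tab y S by simp
  have "cuts_le A B A' B' i j" for i j
    unfolding cuts_le_def
  proof
    fix t assume t: "t \<in> {i..j}"
    obtain D where D: "decreasing_set w D" "D \<subseteq> {i..<j}" "cut_size A B i j t \<le> card D"
      using cut_size_le_decreasing_set[OF two_w t] by blast
    have "decreasing_set y D" using D(1) inv perm by (auto simp: decreasing_set_def)
    then obtain t' where "t' \<in> {i..j}" "card D \<le> cut_size A' B' i j t'"
      using decreasing_set_le_cut_size[OF two_y _ D(2)] t by auto
    then show "\<exists>t'\<in>{i..j}. cut_size A B i j t \<le> cut_size A' B' i j t'"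
      using D(3) order_trans by blast
  qed
  then show thesis using that S assms(3) by (simp add: standard_tableaux_def)
qed

lemma duflo_le_imp_cuts_le:
  assumes "duflo_le n (tab A B) (tab A' B')" "ballot A B" "ballot A' B'"
  shows "cuts_le A B A' B' i j"
proof -
  obtain P k where P: "1 \<le> k" "P 1 = tab A B" "P k = tab A' B'"
    "\<And>l. 1 \<le> l \<Longrightarrow> l \<le> k \<Longrightarrow> P l \<in> standard_tableaux n"
    "\<And>l. 1 \<le> l \<Longrightarrow> l < k \<Longrightarrow> duflo_step n (P l) (P (Suc l))"
    using assms(1) unfolding duflo_le_def duflo_step_def by blast
  have "\<exists>C D. P l = tab C D \<and> ballot C D \<and> cuts_le A B C D i j" if "1 \<le> l" "l \<le> k" for l
    using that
  proof (induction l rule: dec_induct)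
    case base
    then show ?case using P(2) assms(2) cuts_le_refl
      by (intro exI[of _ A] exI[of _ B]) simp
  next
    case (step l)
    then obtain C D where "P l = tab C D" "ballot C D" "cuts_le A B C D i j" by auto
    then show ?case
      using duflo_step_cuts_le[of n C D "P (Suc l)"] P(4)[of "Suc l"] P(5)[of l] step cuts_le_trans
      by (metis Suc_leD Suc_le_eq le_Suc_eq)
  qed
  then obtain C D where "P k = tab C D" "ballot C D" "cuts_le A B C D i j" using P(1) by blast
  moreover from this have "C = A' \<and> D = B'"
    using P(3) assms(3) ballot_empty[of B'] ballot_empty[of D] by (intro tab_inj) (auto simp: ballot_def)
  ultimately show ?thesis by simp
qed

subsection \<open>Arcs\<close>

text \<open>On the span of the arc of \<open>B'\<close> closing at \<open>d\<close>, no cut of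
  \<open>S\<close> exceeds half the length \<open>m\<close>, so by the chain order no cut of
  \<open>T\<close> does. The two extreme cuts then force \<open>A\<close> and \<open>B\<close> to
  have exactly \<open>m\<close> letters each there, and \<open>d \<in> A\<close> would make the cut
  at \<open>d\<close> too large.\<close>

lemma chain_imp_balanced:
  assumes bal: "ballot A' B'" and un: "A \<union> B = {1..n}" "A' \<union> B' = {1..n}"
    and fin: "finite A" "finite B" "A \<inter> B = {}"
    and le: "\<And>i j. 1 \<le> i \<Longrightarrow> i < j \<Longrightarrow> j \<le> n \<Longrightarrow> cuts_le A B A' B' i (Suc j)"
    and d: "d \<in> B'"
  obtains c where "1 \<le> c" "c < d" "2 * card (B' \<inter> {c..<Suc d}) = Suc d - c" "d \<in> B"
    "card (B \<inter> {c..<Suc d}) = card (B' \<inter> {c..<Suc d})"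
proof -
  have fin': "finite A'" "finite B'" "A' \<inter> B' = {}" using bal by (auto simp: ballot_def)
  have total: "card (A \<inter> {i..<Suc d}) + card (B \<inter> {i..<Suc d}) = Suc d - i"
    if "1 \<le> i" "d \<le> n" "finite A" "finite B" "A \<inter> B = {}" "A \<union> B = {1..n}" for A B i
  proof -
    have "(A \<inter> {i..<Suc d}) \<union> (B \<inter> {i..<Suc d}) = {i..<Suc d}" using that by auto
    then show ?thesis using that
      by (subst card_Un_disjoint[symmetric]) auto
  qed
  have dn: "1 \<le> d" "d \<le> n" using d un(2) by auto
  \<comment> \<open>\<open>c = Max K\<close> is the partner of \<open>d\<close> in the parenthesis matching of \<open>S\<close>.\<close>
  define K where "K = {c. 1 \<le> c \<and> c \<le> d \<and> card (B' \<inter> {c..<Suc d}) \<le> card (A' \<inter> {c..<Suc d})}"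
  have "B' \<inter> {1..<Suc d} = B' \<inter> {..d}" "A' \<inter> {1..<Suc d} = A' \<inter> {..d}" using un(2) by auto
  then have "1 \<in> K" using bal dn by (simp add: K_def ballot_def)
  moreover have finK: "finite K" by (rule finite_subset[of _ "{..d}"]) (auto simp: K_def)
  ultimately have cK: "Max K \<in> K" by (metis Max_in empty_iff)
  define c where "c = Max K"
  have c: "1 \<le> c" "c \<le> d" "card (B' \<inter> {c..<Suc d}) \<le> card (A' \<inter> {c..<Suc d})"
    using cK by (auto simp: K_def c_def)
  have above: "card (A' \<inter> {t..<Suc d}) < card (B' \<inter> {t..<Suc d})" if "c < t" "t \<le> d" for t
    using Max_ge[OF finK, of t] that c(1) unfolding c_def[symmetric] by (fastforce simp: K_def)
  have "d \<notin> A'" using d fin'(3) by auto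
  then have "c \<noteq> d" using c(3) card_Int_singleton[of A' d] card_Int_singleton[of B' d] d by auto
  then have cd: "c < d" using c(2) by simp
  define m where "m = card (B' \<inter> {c..<Suc d})"
  \<comment> \<open>By maximality of \<open>c\<close> the count of \<open>A'\<close> is strictly
    smaller from \<open>Suc c\<close> on, and the letter \<open>c\<close> can add at most one to
    it.\<close>
  have "card (A' \<inter> {c..<Suc d}) \<le> m"
    using card_Int_split[OF fin'(1), of c "Suc c" "Suc d"] card_Int_singleton[of A' c]
      card_Int_split[OF fin'(2), of c "Suc c" "Suc d"] above[of "Suc c"] cd by (auto simp: m_def)
  then have Am: "card (A' \<inter> {c..<Suc d}) = m" using c(3) by (simp add: m_def)
  then have m2: "2 * m = Suc d - c"
    using total[OF c(1) dn(2) fin' un(2)] by (simp add: m_def)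
  have "cut_size A' B' c (Suc d) t \<le> m" if t: "t \<in> {c..Suc d}" for t
  proof -
    have "card (A' \<inter> {t..<Suc d}) \<le> card (B' \<inter> {t..<Suc d})"
      using above[of t] Am t by (cases "t = c"; cases "t = Suc d") (auto simp: m_def)
    then show ?thesis
      using card_Int_split[OF fin'(2), of c t "Suc d"] t by (simp add: cut_size_def m_def)
  qed
  then have cut: "cut_size A B c (Suc d) t \<le> m" if "t \<in> {c..Suc d}" for t
    using le[OF c(1) cd dn(2)] that unfolding cuts_le_def by (meson order_trans)
  \<comment> \<open>The cut at \<open>c\<close> sees only \<open>A\<close>, the cut at
    \<open>Suc d\<close> only \<open>B\<close>.\<close>
  have "card (A \<inter> {c..<Suc d}) \<le> m" "card (B \<inter> {c..<Suc d}) \<le> m"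
    using cut[of c] cut[of "Suc d"] cd by (auto simp: cut_size_def)
  then have B: "card (B \<inter> {c..<Suc d}) = m"
    using total[OF c(1) dn(2) fin un(1)] m2 by simp
  have "d \<in> B"
  proof (rule ccontr)
    assume "d \<notin> B"
    moreover have "d \<in> A \<union> B" unfolding un(1) using dn by simp
    ultimately have "d \<in> A" by blast
    then have "cut_size A B c (Suc d) d = m + 1"
      using B card_Int_split[OF fin(2), of c d "Suc d"] card_Int_singleton[of A d]
        card_Int_singleton[of B d] cd \<open>d \<notin> B\<close> by (simp add: cut_size_def)
    then show False using cut[of d] cd by simp
  qed
  then show thesis using that[of c] c(1) cd m2 B by (simp add: m_def)
qed

text \<open>\<open>B\<close> and \<open>B'\<close> are second columns; the window \<open>[c, d]\<close> is the span of the arc of \<open>B'\<close> closing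
  at \<open>d\<close>.\<close>

definition arcs_agree :: "nat set \<Rightarrow> nat set \<Rightarrow> bool" where
  "arcs_agree B B' \<longleftrightarrow> (\<forall>d\<in>B'. \<exists>c\<ge>1. c \<le> d \<and> B \<inter> {c..<Suc d} = B' \<inter> {c..<Suc d} \<and>
     2 * card (B' \<inter> {c..<Suc d}) = Suc d - c)"

lemma arcs_agreeE:
  assumes "arcs_agree B B'" "d \<in> B'"
  obtains c where "1 \<le> c" "c \<le> d" "B \<inter> {c..<Suc d} = B' \<inter> {c..<Suc d}"
    "2 * card (B' \<inter> {c..<Suc d}) = Suc d - c"
  using bspec[OF assms(1)[unfolded arcs_agree_def] assms(2)] that by (elim exE conjE)

lemma arcs_agree_subset: "arcs_agree B B' \<Longrightarrow> B' \<subseteq> B"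
proof
  fix d assume "arcs_agree B B'" and d: "d \<in> B'"
  then obtain c where "c \<le> d" and eq: "B \<inter> {c..<Suc d} = B' \<inter> {c..<Suc d}"
    by (rule arcs_agreeE)
  then have "d \<in> B' \<inter> {c..<Suc d}" using d by simp
  then show "d \<in> B" unfolding eq[symmetric] by blast
qed

text \<open>Running over all \<open>d\<close>, the preceding lemma gives
  \<open>B' \<subseteq> B\<close>; with equal counts on the span of an arc, the two sets agree
  there.\<close>

lemma chain_imp_arcs_agree:
  assumes "ballot A' B'" "A \<union> B = {1..n}" "A' \<union> B' = {1..n}"
    and "finite A" "finite B" "A \<inter> B = {}"
    and "\<And>i j. 1 \<le> i \<Longrightarrow> i < j \<Longrightarrow> j \<le> n \<Longrightarrow> cuts_le A B A' B' i (Suc j)"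
  shows "arcs_agree B B'"
  unfolding arcs_agree_def
proof
  have sub: "B' \<subseteq> B"
  proof
    fix d assume "d \<in> B'"
    from chain_imp_balanced[OF assms this] show "d \<in> B" by blast
  qed
  fix d assume "d \<in> B'"
  from chain_imp_balanced[OF assms this] obtain c where c: "1 \<le> c" "c < d"
    "2 * card (B' \<inter> {c..<Suc d}) = Suc d - c"
    "card (B \<inter> {c..<Suc d}) = card (B' \<inter> {c..<Suc d})" by blast
  have "B' \<inter> {c..<Suc d} = B \<inter> {c..<Suc d}"
    using sub c(4) assms(5) by (intro card_subset_eq) auto
  from this[symmetric] show "\<exists>c\<ge>1. c \<le> d \<and> B \<inter> {c..<Suc d} = B' \<inter> {c..<Suc d} \<and>
     2 * card (B' \<inter> {c..<Suc d}) = Suc d - c"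
    using c(1,3) less_imp_le[OF c(2)] by blast
qed

subsection \<open>Duflo steps between two-column tableaux\<close>

lemma insert_increasing:
  assumes "finite A" "finite B" "A = {} \<longrightarrow> B = {}" "sorted_wrt (<) xs"
    and "\<forall>a\<in>A. \<forall>x\<in>set xs. a < x"
  shows "foldr column_insert (rev xs) (tab A B) = tab (A \<union> set xs) B"
  using assms
proof (induction xs arbitrary: A)
  case (Cons x xs)
  have "column_insert x (tab A B) = tab (insert x A) B"
    using Cons.prems by (intro column_insert_append) auto
  moreover have "foldr column_insert (rev xs) (tab (insert x A) B) = tab (insert x A \<union> set xs) B"
    using Cons.prems by (intro Cons.IH) auto
  ultimately show ?case by simp
qed simp

text \<open>The letters of \<open>as\<close> enter smallest first. The \<open>k\<close>-th one bumps
  the \<open>k\<close>-th letter of \<open>bs\<close>, which goes to the bottom of the second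
  column; when \<open>bs\<close> is used up, the rest of \<open>as\<close> is appended.\<close>

lemma insert_bumping:
  assumes "finite A" "finite B" "A = {} \<longrightarrow> B = {}" "sorted_wrt (<) as" "sorted_wrt (<) bs"
    and "\<And>k. k < length bs \<Longrightarrow> k < length as \<and> as ! k < bs ! k" "set as \<inter> set bs = {}"
    and "\<forall>a\<in>A. \<forall>x\<in>set as \<union> set bs. a < x" "\<forall>b\<in>B. \<forall>x\<in>set bs. b < x"
  shows "foldr column_insert (rev as) (tab (A \<union> set bs) B) = tab (A \<union> set as) (B \<union> set bs)"
  using assms
proof (induction as arbitrary: A B bs)
  case Nil
  from Nil.prems(6)[of 0] have "bs = []" by auto
  then show ?case by simp
next
  case (Cons a as)
  show ?case
  proof (cases bs)
    case Nil
    then show ?thesis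
      using insert_increasing[OF Cons.prems(1-4)] Cons.prems(8) by auto
  next
    case bs: (Cons b bs')
    have ab: "a < b" using Cons.prems(6)[of 0] bs by simp
    have bb: "\<forall>x\<in>set bs'. b < x" using Cons.prems(5) bs by simp
    have b: "b \<notin> A" "b \<notin> set bs'" "a \<notin> A \<union> set bs" "a \<noteq> b"
      using Cons.prems(7,8) bb bs by auto
    have min: "\<forall>y\<in>A \<union> set bs. y < b \<longrightarrow> y < a" using Cons.prems(8) bb bs by auto
    have "column_insert a (tab (A \<union> set bs) B) = tab (insert a (A \<union> set bs - {b})) (insert b B)"
      using Cons.prems(1,2,9) b(3) ab min bs by (intro column_insert_bump(1)) auto
    also have "insert a (A \<union> set bs - {b}) = insert a A \<union> set bs'" using b bs by auto
    finally have step: "column_insert a (tab (A \<union> set bs) B) = tab (insert a A \<union> set bs') (insert b B)" .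
    have "foldr column_insert (rev as) (tab (insert a A \<union> set bs') (insert b B)) =
      tab (insert a A \<union> set as) (insert b B \<union> set bs')"
    proof (rule Cons.IH)
      show "k < length as \<and> as ! k < bs' ! k" if "k < length bs'" for k
        using Cons.prems(6)[of "Suc k"] bs that by simp
      show "\<forall>y\<in>insert a A. \<forall>x\<in>set as \<union> set bs'. y < x"
        using Cons.prems(4,8) ab bb bs by (auto intro: less_trans)
    qed (use Cons.prems bs bb in auto)
    then show ?thesis using step bs by simp
  qed
qed

text \<open>A word of the tableau adapted to splitting it by value. The end of the word is inserted
  first, so the lower block precedes the upper one; within a block the future second column goes in
  first and is then bumped over by the first.\<close>

lemma tableau_of_split_word:
  assumes "ballot A1 B1" "ballot A2 B2" "\<forall>x\<in>A1 \<union> B1. \<forall>y\<in>A2 \<union> B2. x < y"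
  shows "tableau_of_word (rev (sorted_list_of_set A2) @ rev (sorted_list_of_set B2) @
      rev (sorted_list_of_set A1) @ rev (sorted_list_of_set B1)) = tab (A1 \<union> A2) (B1 \<union> B2)"
proof -
  have block: "foldr column_insert (rev (sorted_list_of_set A2) @ rev (sorted_list_of_set B2))
      (tab A B) = tab (A \<union> A2) (B \<union> B2)"
    if "finite A" "finite B" "A = {} \<longrightarrow> B = {}" "ballot A2 B2"
      "\<forall>x\<in>A \<union> B. \<forall>y\<in>A2 \<union> B2. x < y" for A B A2 B2
  proof -
    have fin: "finite A2" "finite B2" "A2 \<inter> B2 = {}" using that(4) by (auto simp: ballot_def)
    have "foldr column_insert (rev (sorted_list_of_set B2)) (tab A B) = tab (A \<union> B2) B"
      using insert_increasing[OF that(1-3), of "sorted_list_of_set B2"] that(5) fin by auto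
    moreover have "foldr column_insert (rev (sorted_list_of_set A2)) (tab (A \<union> B2) B) =
        tab (A \<union> A2) (B \<union> B2)"
      using insert_bumping[OF that(1-3), of "sorted_list_of_set A2" "sorted_list_of_set B2"]
        that(5) fin rows_if_ballot[OF that(4)] by auto
    ultimately show ?thesis by simp
  qed
  have "foldr column_insert (rev (sorted_list_of_set A1) @ rev (sorted_list_of_set B1)) [] =
      tab A1 B1"
    using block[of "{}" "{}" A1 B1] assms(1) by (simp add: tab_def)
  moreover have "finite A1" "finite B1" "A1 = {} \<longrightarrow> B1 = {}"
    using assms(1) ballot_empty[of B1] by (auto simp: ballot_def)
  ultimately show ?thesis
    using block[of A1 B1 A2 B2] assms(2,3) by (simp add: tableau_of_word_def)
qed

text \<open>The hypothesis \<open>suffix\<close> says that the entries above \<open>b\<close> form a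
  ballot pair of their own, so that \<open>b\<close> closes an outermost arc. Both tableaux then
  split at \<open>b\<close> with the same upper block. In the lower block \<open>b\<close> is the
  largest letter, and its change of column is achieved by moving it to the left past the letters of
  \<open>A1\<close>.\<close>

lemma duflo_step_flip:
  assumes bal: "ballot A B" and un: "A \<union> B = {1..n}" and b: "b \<in> B"
    and suffix: "\<And>t. card (B \<inter> {Suc b..<t}) \<le> card (A \<inter> {Suc b..<t})"
  shows "duflo_step n (tab A B) (tab (insert b A) (B - {b}))"
proof -
  have fin: "finite A" "finite B" "A \<inter> B = {}" using bal by (auto simp: ballot_def)
  define A1 B1 A2 B2 where "A1 = A \<inter> {..b}" and "B1 = B \<inter> {..b}"
    and "A2 = A \<inter> {b<..}" and "B2 = B \<inter> {b<..}"
  note defs = A1_def B1_def A2_def B2_def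
  let ?l = sorted_list_of_set
  have "ballot A1 B1"
    using bal by (auto simp: ballot_def defs Int_assoc)
  have "ballot A2 B2"
    unfolding ballot_def
  proof (intro conjI allI)
    fix t
    have "B2 \<inter> {..t} = B \<inter> {Suc b..<Suc t}" "A2 \<inter> {..t} = A \<inter> {Suc b..<Suc t}"
      by (auto simp: defs)
    then show "card (B2 \<inter> {..t}) \<le> card (A2 \<inter> {..t})" using suffix by simp
  qed (use fin in \<open>auto simp: defs\<close>)
  have bA: "b \<notin> A1" and bB: "b \<in> B1" using b fin(3) by (auto simp: defs)
  have bal1': "ballot (insert b A1) (B1 - {b})"
    using \<open>ballot A1 B1\<close> fin by (rule_tac ballot_mono) (auto simp: defs)
  define u where "u = rev (?l A2) @ rev (?l B2)"
  define v where "v = rev (?l (B1 - {b}))"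
  have lA: "?l (insert b A1) = ?l A1 @ [b]"
    using append_column[of A1 b] fin bA by (force simp: defs le_less)
  have "\<forall>a\<in>B1 - {b}. a < b" "finite (B1 - {b})" using fin by (auto simp: defs)
  moreover have "insert b (B1 - {b}) = B1" using bB by blast
  ultimately have lB: "?l B1 = ?l (B1 - {b}) @ [b]"
    using append_column[of "B1 - {b}" b] by (simp only:)
  have w: "tableau_of_word (u @ rev (?l A1) @ [b] @ v) = tab A B"
  proof -
    have "A1 \<union> A2 = A" "B1 \<union> B2 = B" by (auto simp: defs)
    moreover have "\<forall>x\<in>A1 \<union> B1. \<forall>y\<in>A2 \<union> B2. x < y" by (auto simp: defs)
    ultimately show ?thesis
      using tableau_of_split_word[OF \<open>ballot A1 B1\<close> \<open>ballot A2 B2\<close>] lB by (simp add: u_def v_def)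
  qed
  have y: "tableau_of_word (u @ [b] @ rev (?l A1) @ v) = tab (insert b A) (B - {b})"
  proof -
    have "insert b A1 \<union> A2 = insert b A" "B1 - {b} \<union> B2 = B - {b}" by (auto simp: defs)
    moreover have "\<forall>x\<in>insert b A1 \<union> (B1 - {b}). \<forall>y\<in>A2 \<union> B2. x < y" by (auto simp: defs)
    ultimately show ?thesis
      using tableau_of_split_word[OF bal1' \<open>ballot A2 B2\<close>] lA by (simp add: u_def v_def)
  qed
  have sets: "set u = A2 \<union> B2" "set v = B1 - {b}" "set (?l A1) = A1"
    using fin by (auto simp: u_def v_def defs)
  have "A2 \<union> B2 \<union> A1 \<union> {b} \<union> (B1 - {b}) = {1..n}" unfolding un[symmetric] using b by (auto simp: defs)
  moreover have "distinct (u @ rev (?l A1) @ [b] @ v)"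
    using fin b by (auto simp: sets) (auto simp: u_def v_def defs)
  ultimately have perm: "u @ rev (?l A1) @ [b] @ v \<in> permutations_of_set {1..n}"
    "u @ [b] @ rev (?l A1) @ v \<in> permutations_of_set {1..n}"
    using sets by (auto simp: permutations_of_set_def)
  \<comment> \<open>The two words differ only in the order of \<open>b\<close> and the letters of
    \<open>A1\<close>, and each of these pairs becomes an inversion.\<close>
  have "\<forall>p\<in>A1. p < b" using bA by (auto simp: defs le_less)
  then have "right_weak_le n (u @ rev (?l A1) @ [b] @ v) (u @ [b] @ rev (?l A1) @ v)"
    unfolding right_weak_le_iff[OF perm] by (auto simp: precedes_append sets)
  then show ?thesis
    unfolding duflo_step_def word_class_def using w y perm by blast
qed

lemma duflo_le_refl: "T \<in> standard_tableaux n \<Longrightarrow> duflo_le n T T"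
  unfolding duflo_le_def by (intro exI[of _ "\<lambda>_. T"] exI[of _ 1]) auto

lemma duflo_le_step:
  assumes "duflo_step n T U" "duflo_le n U S" "T \<in> standard_tableaux n"
  shows "duflo_le n T S"
proof -
  obtain P k where P: "1 \<le> k" "P 1 = U" "P k = S"
    "\<And>l. 1 \<le> l \<Longrightarrow> l \<le> k \<Longrightarrow> P l \<in> standard_tableaux n"
    "\<And>l. 1 \<le> l \<Longrightarrow> l < k \<Longrightarrow> duflo_step n (P l) (P (Suc l))"
    using assms(2) unfolding duflo_le_def duflo_step_def by blast
  \<comment> \<open>The chain for \<open>U\<close> is shifted by one place, since chains start at
    index 1.\<close>
  define Q where "Q l = (if l = 1 then T else P (l - 1))" for l
  have "Q l \<in> standard_tableaux n" if "1 \<le> l" "l \<le> Suc k" for l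
    using that assms(3) P(4)[of "l - 1"] by (auto simp: Q_def)
  moreover have "duflo_step n (Q l) (Q (Suc l))" if "1 \<le> l" "l < Suc k" for l
    using that assms(1) P(2) P(5)[of "l - 1"] by (cases "l = 1") (auto simp: Q_def)
  moreover have "1 \<le> Suc k" "Q 1 = T" "Q (Suc k) = S" using P(1,3) by (auto simp: Q_def)
  ultimately show ?thesis
    unfolding duflo_le_def duflo_step_def[symmetric] by blast
qed

text \<open>Induction on the number of entries of \<open>B\<close> missing in \<open>B'\<close>; the
  largest one, \<open>b\<close>, is flipped. As \<open>B\<close> and \<open>B'\<close> agree on the
  arc spans, no span contains \<open>b\<close>, so the agreement survives the flip.\<close>

lemma arcs_agree_imp_duflo_le:
  assumes "ballot A B" "A \<union> B = {1..n}" "ballot A' B'" "A' \<union> B' = {1..n}" "arcs_agree B B'"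
  shows "duflo_le n (tab A B) (tab A' B')"
  using assms(1,2,5)
proof (induction "card (B - B')" arbitrary: A B rule: less_induct)
  case less
  note bal = less.prems(1) and un = less.prems(2) and agree = less.prems(3)
  have fin: "finite A" "finite B" "A \<inter> B = {}" using bal by (auto simp: ballot_def)
  have fin': "finite A'" "finite B'" "A' \<inter> B' = {}" using assms(3) by (auto simp: ballot_def)
  have sub: "B' \<subseteq> B" by (rule arcs_agree_subset[OF agree])
  have std: "tab A B \<in> standard_tableaux n" by (rule tab_in_standard_tableaux[OF bal un])
  show ?case
  proof (cases "B = B'")
    case True
    then have "A = A'" using un assms(4) fin(3) fin'(3) by blast
    then show ?thesis using True std duflo_le_refl by simp
  next
    case False
    define b where "b = Max (B - B')"
    have ne: "B - B' \<noteq> {}" "finite (B - B')" using False sub fin by auto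
    have b: "b \<in> B" "b \<notin> B'" using Max_in[OF ne(2,1)] by (auto simp: b_def)
    have b_max: "d \<in> B'" if "d \<in> B" "b < d" for d
      using Max_ge[OF ne(2), of d] that unfolding b_def by fastforce
    have avoid: "b \<notin> {c..<Suc d}" if "B \<inter> {c..<Suc d} = B' \<inter> {c..<Suc d}" for c d
      using b that by blast
    have suffix: "card (B \<inter> {Suc b..<t}) \<le> card (A \<inter> {Suc b..<t})" for t
    proof (induction t rule: less_induct)
      case (less t)
      show ?case
      proof (cases "t \<le> Suc b")
        case True
        then show ?thesis by simp
      next
        case False
        then obtain d where t: "t = Suc d" "b < d" by (cases t) auto
        note splitA = card_Int_split[OF fin(1)] and splitB = card_Int_split[OF fin(2)]
        show ?thesis
        proof (cases "d \<in> B")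
          case True
          \<comment> \<open>Above \<open>b\<close> every letter of \<open>B\<close> closes an arc of
            \<open>B'\<close>. Its span avoids \<open>b\<close>, hence starts above it, and is
            balanced for \<open>A\<close> and \<open>B\<close>; it can be cut off, leaving the
            inequality at \<open>c\<close>.\<close>
          obtain c where c: "1 \<le> c" "c \<le> d" "B \<inter> {c..<Suc d} = B' \<inter> {c..<Suc d}"
            "2 * card (B' \<inter> {c..<Suc d}) = Suc d - c"
            by (rule arcs_agreeE[OF agree b_max[OF True t(2)]])
          have bc: "b < c" using avoid[OF c(3)] t(2) by auto
          have "d \<in> {1..n}" using True un by blast
          then have "(A \<inter> {c..<Suc d}) \<union> (B \<inter> {c..<Suc d}) = {c..<Suc d}"
            unfolding Int_Un_distrib2[symmetric] un using c(1) by auto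
          then have "card (A \<inter> {c..<Suc d}) + card (B \<inter> {c..<Suc d}) = Suc d - c"
            using fin by (subst card_Un_disjoint[symmetric]) auto
          then have "card (A \<inter> {c..<Suc d}) = card (B \<inter> {c..<Suc d})" using c(3,4) by simp
          then show ?thesis
            using splitA[of "Suc b" c "Suc d"] splitB[of "Suc b" c "Suc d"] less[of c] bc c(2) t(1)
            by simp
        next
          case False
          then show ?thesis
            using splitA[of "Suc b" d "Suc d"] splitB[of "Suc b" d "Suc d"] less[of d] t
              card_Int_singleton[of B d] by simp
        qed
      qed
    qed
    have bal': "ballot (insert b A) (B - {b})"
      using bal fin by (rule_tac ballot_mono) auto
    have un': "insert b A \<union> (B - {b}) = {1..n}" unfolding un[symmetric] using b by blast
    have agree': "arcs_agree (B - {b}) B'"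
      unfolding arcs_agree_def
    proof
      fix d assume "d \<in> B'"
      then obtain c where c: "1 \<le> c" "c \<le> d" "B \<inter> {c..<Suc d} = B' \<inter> {c..<Suc d}"
        "2 * card (B' \<inter> {c..<Suc d}) = Suc d - c"
        by (rule arcs_agreeE[OF agree])
      have "(B - {b}) \<inter> {c..<Suc d} = B' \<inter> {c..<Suc d}" using avoid[OF c(3)] c(3) by blast
      then show "\<exists>c\<ge>1. c \<le> d \<and> (B - {b}) \<inter> {c..<Suc d} = B' \<inter> {c..<Suc d} \<and>
          2 * card (B' \<inter> {c..<Suc d}) = Suc d - c"
        using c by (intro exI[of _ c] conjI)
    qed
    have "B - {b} - B' = (B - B') - {b}" by blast
    then have "card (B - {b} - B') < card (B - B')"
      using b ne(2) by (metis DiffI card_Diff1_less)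
    then have "duflo_le n (tab (insert b A) (B - {b})) (tab A' B')"
      using less.hyps bal' un' agree' by blast
    then show ?thesis
      using duflo_step_flip[OF bal un b(1) suffix] duflo_le_step std by blast
  qed
qed

theorem corollary3p14:
  fixes n :: nat and T S :: tableau
  assumes "n \<ge> 1"
    and "T \<in> standard_tableaux2 n" and "S \<in> standard_tableaux2 n"
  shows "chain_le n T S \<longleftrightarrow> duflo_le n T S"
proof -
  obtain A B where T: "T = tab A B" "ballot A B" "A \<union> B = {1..n}"
    using assms(2) young_tableau_two_columns[of T]
    by (metis (mono_tags, lifting) mem_Collect_eq standard_tableaux2_def standard_tableaux_def)
  obtain A' B' where S: "S = tab A' B'" "ballot A' B'" "A' \<union> B' = {1..n}"
    using assms(3) young_tableau_two_columns[of S]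
    by (metis (mono_tags, lifting) mem_Collect_eq standard_tableaux2_def standard_tableaux_def)
  have "chain_le n T S \<longleftrightarrow>
      (\<forall>i j. 1 \<le> i \<and> i < j \<and> j \<le> n \<longrightarrow> cuts_le A B A' B' i (Suc j))"
    using chain_le_iff_cuts_le[OF T(2,3) S(2,3)] T(1) S(1) by simp
  moreover have "duflo_le n T S"
    if "\<forall>i j. 1 \<le> i \<and> i < j \<and> j \<le> n \<longrightarrow> cuts_le A B A' B' i (Suc j)"
  proof -
    have "arcs_agree B B'"
      using chain_imp_arcs_agree[OF S(2) T(3) S(3)] T(2) that by (simp add: ballot_def)
    then show ?thesis using arcs_agree_imp_duflo_le[OF T(2,3) S(2,3)] T(1) S(1) by simp
  qed
  moreover have "cuts_le A B A' B' i (Suc j)" if "duflo_le n T S" for i j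
    using duflo_le_imp_cuts_le[of n A B A' B'] that T(1,2) S(1,2) by simp
  ultimately show ?thesis by blast
qed

end
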